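(* A finite $3$-group $G$ has the cut-property if, and only if, $x^{2}$ is conjugate to $x^{-1}$ in $G$ for all $x \in G$. Furthermore, if a finite $3$-group $G$ has the cut-property, then each quotient $\gamma_i(G)/\gamma_{i+1}(G)$ of successive terms in the lower central series of $G$, as well as each quotient $\mathcal{Z}_{i+1}(G)/\mathcal{Z}_i(G)$ of successive terms in the upper central series of $G$, is of exponent $3$.
   Context: For a finite group $G$, let $\mathcal{U}(\mathbb{Z}[G])$ denote the group of units of the integral group ring $\mathbb{Z}[G]$ and $\mathcal{Z}(\cdot)$ the centre of a group. A finite group $G$ has the cut-property if all central units of $\mathbb{Z}[G]$ are trivial, i.e. $\mathcal{Z}(\mathcal{U}(\mathbb{Z}[G])) = \pm\mathcal{Z}(G) = \{\pm g : g \in \mathcal{Z}(G)\}$. The lower central series of $G$ is written $G = \gamma_1(G) \supset \gamma_2(G) \supset \cdots \supset \gamma_n(G) = \langle 1 \rangle$ and the upper central series is written $\langle 1 \rangle = \mathcal{Z}_0(G) \subset \mathcal{Z}_1(G) \subset \cdots \subset \mathcal{Z}_n(G) = G$; both are strictly monotone and stop when they reach $\langle 1\rangle$, respectively $G$, so the quotients in question are non-trivial. *)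

theory Defs
  imports "HOL-Algebra.Algebra"
begin

definition center :: "('a, 'b) monoid_scheme \<Rightarrow> 'a set" where
  "center G = {z \<in> carrier G. \<forall>g \<in> carrier G. z \<otimes>\<^bsub>G\<^esub> g = g \<otimes>\<^bsub>G\<^esub> z}"

definition conjugate :: "('a, 'b) monoid_scheme \<Rightarrow> 'a \<Rightarrow> 'a \<Rightarrow> bool" where
  "conjugate G x y \<longleftrightarrow> (\<exists>g \<in> carrier G. y = g \<otimes>\<^bsub>G\<^esub> x \<otimes>\<^bsub>G\<^esub> inv\<^bsub>G\<^esub> g)"

text \<open>The value is \<open>0\<close> when the element orders have no common bound.\<close>

definition group_exponent :: "('a, 'b) monoid_scheme \<Rightarrow> nat" where
  "group_exponent G = Lcm (group.ord G ` carrier G)"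

definition commutator_subgroup :: "('a, 'b) monoid_scheme \<Rightarrow> 'a set \<Rightarrow> 'a set \<Rightarrow> 'a set" where
  "commutator_subgroup G H K =
     generate G (\<Union>h \<in> H. \<Union>k \<in> K. {h \<otimes>\<^bsub>G\<^esub> k \<otimes>\<^bsub>G\<^esub> inv\<^bsub>G\<^esub> h \<otimes>\<^bsub>G\<^esub> inv\<^bsub>G\<^esub> k})"

text \<open>Indexing starts at \<open>1\<close>, with \<open>lower_central G 1 = carrier G\<close>; the value at \<open>0\<close> is a
  dummy.\<close>

definition lower_central :: "('a, 'b) monoid_scheme \<Rightarrow> nat \<Rightarrow> 'a set" where
  "lower_central G i = ((\<lambda>H. commutator_subgroup G H (carrier G)) ^^ (i - 1)) (carrier G)"

text \<open>The next term is the preimage of the centre of the quotient by the current term.\<close>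

primrec upper_central :: "('a, 'b) monoid_scheme \<Rightarrow> nat \<Rightarrow> 'a set" where
  "upper_central G 0 = {\<one>\<^bsub>G\<^esub>}"
| "upper_central G (Suc i) =
     {x \<in> carrier G. upper_central G i #>\<^bsub>G\<^esub> x \<in> center (G Mod upper_central G i)}"

text \<open>A formal sum of group elements is represented by its coefficient function, which has finite
  support and vanishes outside the carrier of the group.\<close>

definition group_ring :: "('a, 'b) monoid_scheme \<Rightarrow> ('a \<Rightarrow> int) ring" where
  "group_ring G =
     \<lparr>carrier = {f. finite {x. f x \<noteq> 0} \<and> {x. f x \<noteq> 0} \<subseteq> carrier G},
      monoid.mult = (\<lambda>f g x. if x \<in> carrier G
                then (\<Sum>y | f y \<noteq> 0. f y * g (inv\<^bsub>G\<^esub> y \<otimes>\<^bsub>G\<^esub> x)) else 0),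
      monoid.one = (\<lambda>x. if x = \<one>\<^bsub>G\<^esub> then 1 else 0),
      ring.zero = (\<lambda>_. 0),
      ring.add = (\<lambda>f g x. f x + g x)\<rparr>"

definition group_ring_of :: "'a \<Rightarrow> 'a \<Rightarrow> int" where
  "group_ring_of g = (\<lambda>x. if x = g then 1 else 0)"

definition cut_property :: "('a, 'b) monoid_scheme \<Rightarrow> bool" where
  "cut_property G \<longleftrightarrow>
     center (units_of (group_ring G)) =
       (\<Union>g \<in> center G. {group_ring_of g, \<ominus>\<^bsub>group_ring G\<^esub> group_ring_of g})"

end

theory Submission
  imports Defs "Jordan_Normal_Form.Schur_Decomposition" "HOL-Library.Function_Algebras"
    "HOL-Computational_Algebra.Fundamental_Theorem_Algebra" "HOL-Number_Theory.Cong"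
begin

(* order and conjugate refer to groups throughout, not to polynomial roots and complex numbers *)
hide_const (open) Polynomial.order Conjugate.conjugate

text \<open>
  Let \<open>G\<close> be a group of order \<open>3 ^ n\<close>. The central units of \<open>\<int>[G]\<close> are those units whose
  coefficients are constant on conjugacy classes (\<open>center_units_group_ring\<close>). Both directions of
  the equivalence use that the residues congruent to \<open>1\<close> modulo \<open>3\<close> form a cyclic group modulo
  \<open>3 ^ n\<close>, generated by every residue that is congruent to \<open>1\<close> modulo \<open>3\<close> but not modulo \<open>9\<close>
  (\<open>one_mod_three_generator\<close>).

  \<^emph>\<open>If \<open>x\<^sup>2\<close> is always conjugate to the inverse of \<open>x\<close>, then central units are trivial\<close>
  (\<open>central_unit_trivial\<close>). Let \<open>u\<close> be a central unit and \<open>w = u u*\<close>, where \<open>*\<close> inverts group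
  elements. If \<open>w w = 1\<close>, then comparing coefficients at the identity shows that the squares of
  the coefficients of \<open>w\<close> add up to \<open>1\<close>. The coefficient of \<open>w\<close> at the identity is the sum of the
  squares of the coefficients of \<open>u\<close>, a positive integer, so it is \<open>1\<close>, and \<open>u\<close> has a single
  coefficient, equal to \<open>1\<close> or \<open>-1\<close>. If \<open>w w \<noteq> 1\<close>, then the operator \<open>w\<close> on \<open>\<complex>[G]\<close>, being
  self-adjoint, has a real eigenvalue \<open>t\<close> with \<open>t\<^sup>2 \<noteq> 1\<close> and a central idempotent \<open>E\<close> with
  \<open>w E = t E\<close> (\<open>eigen_idempotent\<close>). The coefficient of \<open>E\<close> at the identity is proportional to the
  trace of an idempotent operator and hence rational; the same holds for the sum of the
  coefficients of \<open>E\<close> along any cyclic subgroup (\<open>cyclic_sum_rational\<close>). A central integral element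
  \<open>f\<close> with \<open>f* = f\<close> takes, by the hypothesis, the same value at \<open>g\<close> and at \<open>g ^ j\<close> for all \<open>j\<close> prime
  to \<open>3\<close>, so the coefficient of \<open>f E\<close> at the identity is a combination of these rational sums with
  denominators that do not depend on \<open>f\<close>. For \<open>f = w ^ m\<close> it is \<open>t ^ m\<close> times a nonzero constant.
  Thus the powers of \<open>t\<close> stay away from \<open>0\<close>, that is, \<open>\<bar>t\<bar> \<ge> 1\<close>; applied to the inverse of \<open>w\<close>
  this gives \<open>\<bar>t\<bar> = 1\<close>, a contradiction (\<open>eigenvalue_norm_ge_one\<close>).

  \<^emph>\<open>If \<open>x\<^sup>2\<close> is not conjugate to the inverse of \<open>x\<close>, then there is a nontrivial central unit\<close>
  (\<open>nontrivial_central_unit\<close>). The element \<open>1 - x + x\<^sup>2 - x\<^sup>3 + x\<^sup>4\<close> is a unit of \<open>\<int>[\<langle>x\<rangle>]\<close>. A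
  suitable power of it has the form \<open>b = 1 + 2 a\<close>, and the Frobenius congruence modulo \<open>4\<close>
  determines \<open>a\<close> modulo \<open>2\<close> (\<open>cyclic_unit\<close>). Since \<open>x\<close> is not conjugate to the power \<open>x ^ (-2)\<close>, a
  conjugate of \<open>x ^ j\<close> with \<open>j\<close> prime to \<open>3\<close> that lies in \<open>\<langle>x\<rangle>\<close> is some \<open>x ^ i\<close> with \<open>i\<close> congruent
  to \<open>j\<close> modulo \<open>9\<close> (\<open>conjugate_power\<close>). So for each \<open>s\<close> prime to \<open>3\<close> the conjugates of the \<open>x ^ i\<close>
  with \<open>i\<close> congruent to \<open>s\<close> modulo \<open>9\<close> form a conjugation-invariant set \<open>D\<close> that does not contain
  the identity, and the explicit form of \<open>a\<close> yields some \<open>s\<close> for which the coefficients of \<open>a\<close> have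
  an odd sum over \<open>D\<close> (\<open>odd_power_class_exists\<close>). Multiplying commuting conjugates of \<open>b\<close> while
  ascending a chain of subgroups, each normalised by the next, gives a central unit
  (\<open>central_unit_exists\<close>). Modulo \<open>4\<close> the terms \<open>2 a\<close> simply add up, and the number of factors is odd,
  so the sum over \<open>D\<close> stays odd. The resulting unit is congruent to \<open>1\<close> modulo \<open>2\<close> and has a
  nonzero coefficient away from the identity, so it is not trivial.

  \<^emph>\<open>The exponents.\<close> If \<open>x\<^sup>2\<close> is conjugate to the inverse of \<open>x\<close>, then \<open>x\<^sup>3\<close> is a commutator of
  \<open>x\<close> with another element (\<open>cube_commutator\<close>), so cubing maps each term of either central series
  into the next smaller one. The quotients are nontrivial because \<open>3\<close>-groups are nilpotent.
\<close>

section \<open>Convolution of functions on a finite group\<close>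

definition delta :: "'a \<Rightarrow> 'a \<Rightarrow> 'k::comm_ring_1" where
  "delta g = (\<lambda>x. if x = g then 1 else 0)"

definition scale :: "'k::comm_ring_1 \<Rightarrow> ('a \<Rightarrow> 'k) \<Rightarrow> 'a \<Rightarrow> 'k" where
  "scale c f = (\<lambda>x. c * f x)"

lemma scale_apply [simp]: "scale c f x = c * f x"
  by (simp add: scale_def)

lemma scale_simps [simp]:
  "scale 0 f = 0" "scale 1 f = f" "scale c 0 = 0" "scale a (scale b f) = scale (a * b) f"
  by (auto simp: fun_eq_iff mult.assoc)

lemma scale_add: "scale c (f + g) = scale c f + scale c g"
  "scale (a + b) f = scale a f + scale b f"
  by (auto simp: fun_eq_iff algebra_simps)

text \<open>Elements of the group algebra over a commutative ring are functions, multiplied by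
  convolution. Allowing arbitrary coefficients makes it possible to view one and the same integral
  element over the complex numbers; functions that vanish outside the carrier form the group
  algebra proper, and \<open>class_fun\<close> singles out its centre.\<close>

locale finite_group = group G for G (structure) +
  assumes finite_carrier: "finite (carrier G)"
begin

lemma sum_inv: "(\<Sum>y\<in>carrier G. h (inv y)) = (\<Sum>y\<in>carrier G. h y)"
  by (rule sum.reindex_bij_witness[of _ "\<lambda>y. inv y" "\<lambda>y. inv y"]) auto

lemma sum_translate:
  assumes "a \<in> carrier G"
  shows "(\<Sum>y\<in>carrier G. h (a \<otimes> y)) = (\<Sum>y\<in>carrier G. h y)"
  by (rule sum.reindex_bij_witness[of _ "\<lambda>y. inv a \<otimes> y" "\<lambda>y. a \<otimes> y"])
    (use assms in \<open>auto simp flip: m_assoc\<close>)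

definition conv :: "('a \<Rightarrow> 'k::comm_ring_1) \<Rightarrow> ('a \<Rightarrow> 'k) \<Rightarrow> 'a \<Rightarrow> 'k" (infixl "\<star>" 70) where
  "f \<star> g = (\<lambda>x. if x \<in> carrier G then \<Sum>y\<in>carrier G. f y * g (inv y \<otimes> x) else 0)"

definition supported :: "('a \<Rightarrow> 'k::comm_ring_1) \<Rightarrow> bool" where
  "supported f \<longleftrightarrow> (\<forall>x. x \<notin> carrier G \<longrightarrow> f x = 0)"

definition class_fun :: "('a \<Rightarrow> 'k::comm_ring_1) \<Rightarrow> bool" where
  "class_fun f \<longleftrightarrow> supported f \<and> (\<forall>g\<in>carrier G. \<forall>x\<in>carrier G. f (g \<otimes> x \<otimes> inv g) = f x)"

definition star :: "('a \<Rightarrow> 'k::comm_ring_1) \<Rightarrow> 'a \<Rightarrow> 'k" where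
  "star f = (\<lambda>x. if x \<in> carrier G then f (inv x) else 0)"

lemma supported_eqI:
  assumes "supported f" "supported g" "\<And>x. x \<in> carrier G \<Longrightarrow> f x = g x"
  shows "f = g"
  using assms unfolding supported_def by (metis ext)

lemma supported_intros [simp, intro]:
  "supported (f \<star> g)" "supported 0" "g' \<in> carrier G \<Longrightarrow> supported (delta g')"
  "supported f \<Longrightarrow> supported g \<Longrightarrow> supported (f + g)"
  "supported f \<Longrightarrow> supported g \<Longrightarrow> supported (f - g)"
  "supported f \<Longrightarrow> supported (scale c f)"
  "supported (star f)"
  by (auto simp: supported_def conv_def delta_def star_def)

lemma supported_sum [intro]: "(\<And>i. i \<in> I \<Longrightarrow> supported (f i)) \<Longrightarrow> supported (sum f I)"
  by (induction I rule: infinite_finite_induct) auto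

lemma conv_apply: "x \<in> carrier G \<Longrightarrow> (f \<star> g) x = (\<Sum>y\<in>carrier G. f y * g (inv y \<otimes> x))"
  by (simp add: conv_def)

lemma conv_apply': "x \<in> carrier G \<Longrightarrow> (f \<star> g) x = (\<Sum>y\<in>carrier G. f (x \<otimes> inv y) * g y)"
proof -
  assume x: "x \<in> carrier G"
  have "(\<Sum>y\<in>carrier G. f y * g (inv y \<otimes> x)) = (\<Sum>y\<in>carrier G. f (inv y) * g (y \<otimes> x))"
    by (subst sum_inv[symmetric]) simp
  also have "\<dots> = (\<Sum>y\<in>carrier G. f (x \<otimes> inv y) * g y)"
    by (rule sum.reindex_bij_witness[of _ "\<lambda>y. y \<otimes> inv x" "\<lambda>y. y \<otimes> x"])
      (use x in \<open>auto simp: m_assoc inv_mult_group\<close>, simp flip: m_assoc)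
  finally show ?thesis using x by (simp add: conv_apply)
qed

lemma conv_one: "(f \<star> g) \<one> = (\<Sum>y\<in>carrier G. f y * g (inv y))"
  by (simp add: conv_apply)

lemma conv_assoc: "f \<star> g \<star> h = f \<star> (g \<star> h)"
proof (rule supported_eqI)
  fix x assume x: "x \<in> carrier G"
  have "(f \<star> g \<star> h) x
      = (\<Sum>z\<in>carrier G. \<Sum>y\<in>carrier G. f y * g (inv y \<otimes> (x \<otimes> inv z)) * h z)"
    using x by (subst conv_apply') (simp_all add: conv_apply sum_distrib_right)
  also have "\<dots> = (\<Sum>y\<in>carrier G. \<Sum>z\<in>carrier G. f y * g (inv y \<otimes> (x \<otimes> inv z)) * h z)"
    by (rule sum.swap)
  also have "\<dots> = (\<Sum>y\<in>carrier G. f y * (g \<star> h) (inv y \<otimes> x))"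
    using x by (intro sum.cong) (simp_all add: conv_apply' sum_distrib_left mult.assoc m_assoc)
  finally show "(f \<star> g \<star> h) x = (f \<star> (g \<star> h)) x"
    using x by (simp add: conv_apply)
qed auto

lemma conv_add: "(f + g) \<star> h = f \<star> h + g \<star> h" "h \<star> (f + g) = h \<star> f + h \<star> g"
  by (auto simp: conv_def fun_eq_iff algebra_simps sum.distrib)

lemma conv_diff: "(f - g) \<star> h = f \<star> h - g \<star> h" "h \<star> (f - g) = h \<star> f - h \<star> g"
  by (auto simp: conv_def fun_eq_iff algebra_simps sum_subtractf)

lemma conv_zero [simp]: "0 \<star> f = 0" "f \<star> 0 = 0"
  by (auto simp: conv_def fun_eq_iff)

lemma conv_scale [simp]: "scale c f \<star> g = scale c (f \<star> g)" "f \<star> scale c g = scale c (f \<star> g)"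
  by (auto simp: conv_def fun_eq_iff sum_distrib_left mult_ac)

lemma conv_sum: "sum f I \<star> g = (\<Sum>i\<in>I. f i \<star> g)" "g \<star> sum f I = (\<Sum>i\<in>I. g \<star> f i)"
  by (induction I rule: infinite_finite_induct) (auto simp: conv_add)

lemma delta_conv: "g \<in> carrier G \<Longrightarrow> x \<in> carrier G \<Longrightarrow> (delta g \<star> f) x = f (inv g \<otimes> x)"
  using finite_carrier by (simp add: conv_apply delta_def if_distrib [of "\<lambda>c. c * _"] sum.delta cong: if_cong)

lemma conv_delta: "g \<in> carrier G \<Longrightarrow> x \<in> carrier G \<Longrightarrow> (f \<star> delta g) x = f (x \<otimes> inv g)"
  using finite_carrier by (simp add: conv_apply' delta_def if_distrib [of "\<lambda>c. _ * c"] sum.delta cong: if_cong)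

lemma delta_mult: "g \<in> carrier G \<Longrightarrow> h \<in> carrier G \<Longrightarrow> delta g \<star> delta h = delta (g \<otimes> h)"
proof (rule supported_eqI)
  fix x assume "g \<in> carrier G" "h \<in> carrier G" "x \<in> carrier G"
  then show "(delta g \<star> delta h) x = delta (g \<otimes> h) x"
    by (auto simp: delta_conv) (auto simp: delta_def inv_solve_left')
qed auto

lemma conv_one_left [simp]: "supported f \<Longrightarrow> delta \<one> \<star> f = f"
  by (rule supported_eqI) (auto simp: delta_conv)

lemma conv_one_right [simp]: "supported f \<Longrightarrow> f \<star> delta \<one> = f"
  by (rule supported_eqI) (auto simp: conv_delta)

lemma class_fun_supported [simp]: "class_fun f \<Longrightarrow> supported f"
  by (simp add: class_fun_def)

lemma class_funD: "class_fun f \<Longrightarrow> g \<in> carrier G \<Longrightarrow> x \<in> carrier G \<Longrightarrow> f (g \<otimes> x \<otimes> inv g) = f x"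
  by (simp add: class_fun_def)

lemma class_fun_commute:
  assumes "class_fun f" shows "f \<star> h = h \<star> f"
proof (rule supported_eqI)
  fix x assume x: "x \<in> carrier G"
  have "(f \<star> h) x = (\<Sum>z\<in>carrier G. h z * f (z \<otimes> (inv z \<otimes> x) \<otimes> inv z))"
    using x by (simp add: conv_apply' mult.commute flip: m_assoc)
  also have "\<dots> = (h \<star> f) x"
    using x assms by (simp add: conv_apply class_funD)
  finally show "(f \<star> h) x = (h \<star> f) x" .
qed auto

lemma class_funI:
  assumes "supported f" "\<And>g. g \<in> carrier G \<Longrightarrow> delta g \<star> f = f \<star> delta g"
  shows "class_fun f"
  unfolding class_fun_def
proof (intro conjI ballI)
  fix g x assume gx: "g \<in> carrier G" "x \<in> carrier G"
  have "(delta g \<star> f) (g \<otimes> x) = (f \<star> delta g) (g \<otimes> x)" using gx assms by simp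
  then show "f (g \<otimes> x \<otimes> inv g) = f x"
    using gx by (simp add: delta_conv conv_delta flip: m_assoc)
qed (use assms in auto)

lemma class_fun_conv [intro]: "class_fun f \<Longrightarrow> class_fun g \<Longrightarrow> class_fun (f \<star> g)"
  by (rule class_funI) (auto, metis class_fun_commute conv_assoc)

lemma class_fun_intros [intro]:
  "class_fun 0" "class_fun (delta \<one>)"
  "class_fun f \<Longrightarrow> class_fun g \<Longrightarrow> class_fun (f + g)"
  "class_fun f \<Longrightarrow> class_fun g \<Longrightarrow> class_fun (f - g)"
  "class_fun f \<Longrightarrow> class_fun (scale c f)"
      apply (auto simp: class_fun_def)
  apply (rule class_funD, rule class_funI, auto simp:)
  done

lemma class_fun_star [intro]:
  assumes "class_fun f" shows "class_fun (star f)"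
  unfolding class_fun_def
proof (intro conjI ballI)
  fix g x assume gx: "g \<in> carrier G" "x \<in> carrier G"
  have "inv (g \<otimes> x \<otimes> inv g) = g \<otimes> inv x \<otimes> inv g"
    using gx by (simp add: inv_mult_group m_assoc)
  then show "star f (g \<otimes> x \<otimes> inv g) = star f x"
    using gx assms by (simp add: star_def class_funD)
qed auto

lemma star_conv: "star (f \<star> g) = star g \<star> star f"
proof (rule supported_eqI)
  fix x assume x: "x \<in> carrier G"
  have "star (f \<star> g) x = (\<Sum>y\<in>carrier G. f y * g (inv y \<otimes> inv x))"
    using x by (simp add: star_def conv_apply)
  also have "\<dots> = (\<Sum>y\<in>carrier G. f (inv y) * g (y \<otimes> inv x))"
    by (subst sum_inv[symmetric]) simp
  also have "\<dots> = (star g \<star> star f) x"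
    using x by (simp add: conv_apply' star_def inv_mult_group mult.commute)
  finally show "star (f \<star> g) x = (star g \<star> star f) x" .
qed auto

lemma star_delta_one [simp]: "star (delta \<one>) = delta \<one>"
proof (rule supported_eqI)
  fix x assume "x \<in> carrier G"
  then show "star (delta \<one>) x = delta \<one> x"
    by (auto simp: star_def delta_def inv_eq_1_iff)
qed auto

lemma star_star [simp]: "supported f \<Longrightarrow> star (star f) = f"
proof (rule supported_eqI)
  fix x assume "x \<in> carrier G"
  then show "star (star f) x = f x" by (simp add: star_def)
qed auto

text \<open>Used for the inclusion of the integers in the complex numbers and for complex
  conjugation.\<close>

lemma conv_map:
  assumes "h 0 = 0" "\<And>a b. h (a + b) = h a + h b" "\<And>a b. h (a * b) = h a * h b"
  shows "h \<circ> (f \<star> g) = (h \<circ> f) \<star> (h \<circ> g)"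
proof -
  have "h (sum k A) = (\<Sum>x\<in>A. h (k x))" for k and A :: "'a set"
    by (induction A rule: infinite_finite_induct) (auto simp: assms)
  then show ?thesis by (auto simp: conv_def fun_eq_iff assms)
qed

section \<open>Polynomials in an element\<close>

definition peval :: "('a \<Rightarrow> 'k::comm_ring_1) \<Rightarrow> 'k poly \<Rightarrow> 'a \<Rightarrow> 'k" where
  "peval w p = fold_coeffs (\<lambda>c f. scale c (delta \<one>) + w \<star> f) p 0"

lemma peval_0 [simp]: "peval w 0 = 0"
  by (simp add: peval_def)

lemma peval_pCons [simp]: "peval w (pCons c p) = scale c (delta \<one>) + w \<star> peval w p"
  by (cases "c = 0 \<and> p = 0") (auto simp: peval_def)

lemma peval_add: "peval w (p + q) = peval w p + peval w q"
  by (rule poly_induct2[of "\<lambda>p q. peval w (p + q) = peval w p + peval w q"])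
    (auto simp: scale_add conv_add)

lemma peval_smult: "peval w (smult c p) = scale c (peval w p)"
  by (rule pCons_induct[of "\<lambda>p. peval w (smult c p) = scale c (peval w p)"])
    (auto simp: scale_add)

lemma supported_peval [simp, intro]: "supported (peval w p)"
  by (rule pCons_induct[of "\<lambda>p. supported (peval w p)"]) auto

lemma peval_mult: "peval w (p * q) = peval w p \<star> peval w q"
  by (rule pCons_induct[of "\<lambda>p. peval w (p * q) = peval w p \<star> peval w q"])
    (auto simp: peval_add peval_smult conv_add conv_assoc)

lemma peval_one [simp]: "peval w 1 = delta \<one>"
  by (simp add: one_pCons)

lemma peval_X: "supported w \<Longrightarrow> peval w [:0, 1:] = w"
  by simp

lemma peval_minus: "peval w (- p) = - peval w p"
  using peval_smult[of w "-1" p] by (auto simp: fun_eq_iff)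

lemma peval_diff: "peval w (p - q) = peval w p - peval w q"
  using peval_add[of w p "-q"] by (simp add: peval_minus)

lemma class_fun_peval [intro]: "class_fun w \<Longrightarrow> class_fun (peval w p)"
  by (rule pCons_induct[of "\<lambda>p. class_fun (peval w p)"]) auto

text \<open>An eigenvector of \<open>w\<close> is an eigenvector of every polynomial in \<open>w\<close>.\<close>

lemma peval_eigen:
  assumes "w \<star> F = scale t F" "supported F"
  shows "peval w p \<star> F = scale (poly p t) F"
  by (rule pCons_induct[of "\<lambda>p. peval w p \<star> F = scale (poly p t) F"])
    (use assms in \<open>auto simp: conv_add conv_assoc scale_add mult.commute\<close>)

end

section \<open>Traces of idempotents\<close>

lemma trace_mult_commute:
  fixes U V :: "'k::comm_ring_1 mat"
  assumes "U \<in> carrier_mat n n" "V \<in> carrier_mat n n"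
  shows "(\<Sum>i<n. (U * V) $$ (i, i)) = (\<Sum>i<n. (V * U) $$ (i, i))"
proof -
  have *: "(\<Sum>i<n. (A * B) $$ (i, i)) = (\<Sum>i<n. \<Sum>j<n. A $$ (i, j) * B $$ (j, i))"
    if "A \<in> carrier_mat n n" "B \<in> carrier_mat n n" for A B :: "'k mat"
    using that by (intro sum.cong) (auto simp: scalar_prod_def lessThan_atLeast0)
  show ?thesis
    unfolding *[OF assms] *[OF assms(2,1)] by (subst sum.swap) (simp add: mult.commute)
qed

text \<open>The trace is a sum of eigenvalues, each of which is \<open>0\<close> or \<open>1\<close>. A similar triangular matrix
  makes them visible.\<close>

lemma idempotent_matrix_trace:
  fixes A :: "complex mat"
  assumes A: "A \<in> carrier_mat n n" and idem: "A * A = A"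
  shows "(\<Sum>i<n. A $$ (i, i)) \<in> \<rat>"
proof -
  obtain es where es: "char_poly A = (\<Prod>e\<leftarrow>es. [:- e, 1:])"
    using char_poly_factorized[OF A] by blast
  obtain B P Q where "schur_decomposition A es = (B, P, Q)" by (metis prod_cases3)
  from schur_decomposition[OF A es this]
  have wit: "similar_mat_wit A B P Q" and tri: "upper_triangular B" by auto
  from similar_mat_witD2[OF A wit]
  have PQ: "P * Q = 1\<^sub>m n" "Q * P = 1\<^sub>m n" and APBQ: "A = P * B * Q"
    and c: "B \<in> carrier_mat n n" "P \<in> carrier_mat n n" "Q \<in> carrier_mat n n" by auto
  have "B = Q * A * P"
  proof -
    have "Q * A * P = (Q * P) * B * (Q * P)"
      using c by (simp add: APBQ assoc_mult_mat[of _ n n _ n _ n])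
    then show ?thesis using c PQ by simp
  qed
  then have "B * B = Q * (A * ((P * Q) * (A * P)))"
    using c A by (simp add: assoc_mult_mat[of _ n n _ n _ n])
  also have "\<dots> = Q * ((A * A) * P)"
    using c A PQ by (simp add: assoc_mult_mat[of _ n n _ n _ n])
  also have "\<dots> = B"
    using c A idem \<open>B = Q * A * P\<close> by (simp add: assoc_mult_mat[of _ n n _ n _ n])
  finally have BB: "B * B = B" .
  have diag: "B $$ (i, i) \<in> {0, 1}" if i: "i < n" for i
  proof -
    have "B $$ (i, j) * B $$ (j, i) = (if j = i then B $$ (i, i) * B $$ (i, i) else 0)" if "j < n" for j
      using tri c i that by (cases "j < i"; cases "j = i") (auto simp: upper_triangular_def)
    then have "(\<Sum>j<n. B $$ (i, j) * B $$ (j, i))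
        = (\<Sum>j<n. if j = i then B $$ (i, i) * B $$ (i, i) else 0)"
      by (intro sum.cong) auto
    also have "\<dots> = B $$ (i, i) * B $$ (i, i)" using i by simp
    finally have "(\<Sum>j<n. B $$ (i, j) * B $$ (j, i)) = B $$ (i, i) * B $$ (i, i)" .
    moreover have "(B * B) $$ (i, i) = (\<Sum>j<n. B $$ (i, j) * B $$ (j, i))"
      using c i by (auto simp: scalar_prod_def lessThan_atLeast0)
    ultimately have "B $$ (i, i) * B $$ (i, i) = B $$ (i, i)" by (simp only: BB)
    then show ?thesis by simp
  qed
  have "(\<Sum>i<n. A $$ (i, i)) = (\<Sum>i<n. (P * (B * Q)) $$ (i, i))"
    using c by (simp add: APBQ assoc_mult_mat[of _ n n _ n _ n])
  also have "\<dots> = (\<Sum>i<n. (B * Q * P) $$ (i, i))"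
    by (rule trace_mult_commute) (use c in auto)
  also have "B * Q * P = B"
    using c PQ by (simp add: assoc_mult_mat[of _ n n _ n _ n])
  also have "(\<Sum>i<n. B $$ (i, i)) \<in> \<rat>"
    using diag by (intro Rats_sum) (auto, metis Rats_0 Rats_1)
  finally show ?thesis .
qed

text \<open>Functions form a vector space, so that the dimension bound applies to the powers of an element.\<close>

interpretation fun_space: vector_space "scale :: 'k::field \<Rightarrow> ('a \<Rightarrow> 'k) \<Rightarrow> 'a \<Rightarrow> 'k"
  by unfold_locales (auto simp: fun_eq_iff algebra_simps)

context finite_group
begin

lemma order_pos: "order G > 0"
  using order_gt_0_iff_finite finite_carrier by blast

lemma pow_cong:
  assumes "g \<in> carrier G" "[a = b] (mod order G)"
  shows "g [^] a = g [^] (b::nat)"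
proof -
  have "g [^] c = g [^] (c mod order G)" for c :: nat
  proof -
    have "g [^] c = g [^] (order G * (c div order G) + c mod order G)" by simp
    also have "\<dots> = (g [^] order G) [^] (c div order G) \<otimes> g [^] (c mod order G)"
      using assms(1) by (simp only: nat_pow_mult nat_pow_pow nat_pow_closed)
    finally show ?thesis using assms(1) by (simp add: pow_order_eq_1)
  qed
  then show ?thesis using assms(2) unfolding cong_def by metis
qed

text \<open>The operator of convolution with \<open>e\<close> has all its diagonal entries equal to the coefficient of
  \<open>e\<close> at the identity, so this coefficient is the trace of an idempotent divided by the group order.\<close>

lemma idempotent_coeff_rational:
  fixes e :: "'a \<Rightarrow> complex"
  assumes "e \<star> e = e"
  shows "e \<one> \<in> \<rat>"
proof -
  define n where "n = order G"
  obtain g where g: "bij_betw g {..<n} (carrier G)"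
    using finite_carrier ex_bij_betw_nat_finite[of "carrier G"]
    by (auto simp: n_def Coset.order_def lessThan_atLeast0)
  then have gc: "\<And>i. i < n \<Longrightarrow> g i \<in> carrier G" by (auto dest: bij_betw_apply)
  define A where "A = mat n n (\<lambda>(i, j). e (inv g i \<otimes> g j))"
  have "A * A = A"
  proof (rule eq_matI)
    fix i j assume "i < dim_row A" "j < dim_col A"
    then have ij: "i < n" "j < n" by (auto simp: A_def)
    have "(A * A) $$ (i, j) = (\<Sum>k<n. e (inv g i \<otimes> g k) * e (inv g k \<otimes> g j))"
      using ij by (auto simp: A_def scalar_prod_def lessThan_atLeast0)
    also have "\<dots> = (\<Sum>y\<in>carrier G. e (inv g i \<otimes> y) * e (inv y \<otimes> g j))"
      by (rule sum.reindex_bij_betw[OF g])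
    also have "\<dots> = (\<Sum>y\<in>carrier G. e (inv g i \<otimes> (g i \<otimes> y)) * e (inv (g i \<otimes> y) \<otimes> g j))"
      by (rule sum_translate[symmetric]) (use gc ij in auto)
    also have "\<dots> = (e \<star> e) (inv g i \<otimes> g j)"
      using gc ij by (simp add: conv_apply inv_mult_group m_assoc flip: m_assoc[of "inv g i" "g i"])
    finally show "(A * A) $$ (i, j) = A $$ (i, j)" using ij assms by (simp add: A_def)
  qed (auto simp: A_def)
  then have "(\<Sum>i<n. A $$ (i, i)) \<in> \<rat>"
    by (intro idempotent_matrix_trace) (auto simp: A_def)
  also have "(\<Sum>i<n. A $$ (i, i)) = of_nat n * e \<one>"
    using gc by (simp add: A_def)
  finally have "of_nat n * e \<one> / of_nat n \<in> \<rat>" by (rule Rats_divide) auto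
  then show ?thesis using order_pos by (simp add: n_def)
qed

text \<open>Convolving \<open>E\<close> with the averaging idempotent of a cyclic subgroup gives another idempotent, as
  \<open>E\<close> is central. Its coefficient at the identity is the average of \<open>E\<close> over that subgroup.\<close>

lemma cyclic_sum_rational:
  fixes E :: "'a \<Rightarrow> complex"
  assumes "class_fun E" "E \<star> E = E" and g: "g \<in> carrier G"
  shows "(\<Sum>j < order G. E (g [^] j)) \<in> \<rat>"
proof -
  define n where "n = order G"
  \<comment> \<open>the coefficient at the identity of a convolution evaluates \<open>E\<close> at inverses of the powers\<close>
  define h where "h = inv g"
  have h: "h \<in> carrier G" "inv h = g" using g by (auto simp: h_def)
  define S :: "'a \<Rightarrow> complex" where "S = (\<Sum>j<n. delta (h [^] j))"
  have suppS: "supported S" using h by (auto simp: S_def)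
  have shift1: "delta h \<star> S = S"
  proof -
    have "delta h \<star> S = (\<Sum>j<n. delta (h [^] Suc j))"
      using h by (simp add: S_def conv_sum delta_mult flip: nat_pow_Suc2 del: nat_pow_Suc)
    also have "\<dots> = (\<Sum>j<Suc n. delta (h [^] j)) - delta \<one>"
      by (simp add: sum.lessThan_Suc_shift del: sum.lessThan_Suc)
    also have "\<dots> = S" using h by (simp add: S_def n_def pow_order_eq_1)
    finally show ?thesis .
  qed
  have shift: "delta (h [^] i) \<star> S = S" for i :: nat
  proof (induction i)
    case (Suc i)
    have "delta (h [^] Suc i) \<star> S = delta (h [^] i) \<star> (delta h \<star> S)"
      using h by (simp add: delta_mult flip: conv_assoc)
    then show ?case using Suc shift1 by simp
  qed (use suppS in auto)
  have SS: "S \<star> S = scale (of_nat n) S"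
  proof -
    have "S \<star> S = (\<Sum>j<n. delta (h [^] j) \<star> S)"
      using conv_sum(1)[of "\<lambda>j. delta (h [^] j)" "{..<n}" S] by (simp only: S_def[symmetric])
    also have "\<dots> = (\<Sum>j<n. S)" by (simp only: shift)
    also have "\<dots> = scale (of_nat n) S" by (induction n) (auto simp: fun_eq_iff algebra_simps)
    finally show ?thesis .
  qed
  define F where "F = scale (1 / of_nat n) (E \<star> S)"
  have "E \<star> S \<star> (E \<star> S) = E \<star> E \<star> (S \<star> S)"
    by (metis conv_assoc class_fun_commute[OF assms(1)])
  then have "F \<star> F = F"
    using order_pos by (simp add: F_def SS assms(2) n_def)
  then have "F \<one> \<in> \<rat>" by (rule idempotent_coeff_rational)
  moreover have "F \<one> = (1 / of_nat n) * (\<Sum>j<n. E (g [^] j))"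
  proof -
    have "(E \<star> S) \<one> = (\<Sum>j<n. (E \<star> delta (h [^] j)) \<one>)"
      unfolding S_def conv_sum by (induction n) auto
    also have "\<dots> = (\<Sum>j<n. E (g [^] j))"
      using g h by (simp add: conv_delta) (metis h_def nat_pow_inv inv_inv nat_pow_closed)
    finally show ?thesis by (simp add: F_def)
  qed
  ultimately have "(1 / of_nat n) * (\<Sum>j<n. E (g [^] j)) \<in> \<rat>" by metis
  then have "of_nat n * ((1 / of_nat n) * (\<Sum>j<n. E (g [^] j))) \<in> \<rat>"
    by (rule Rats_mult[OF Rats_of_nat])
  also have "of_nat n * ((1 / of_nat n) * (\<Sum>j<n. E (g [^] j))) = (\<Sum>j<n. E (g [^] j))"
    using order_pos by (simp add: n_def)
  finally show ?thesis by (simp only: n_def)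
qed

section \<open>Eigenvalues of self-adjoint central elements\<close>

lemma peval_sum: "peval w (sum p A) = (\<Sum>i\<in>A. peval w (p i))"
  by (induction A rule: infinite_finite_induct) (auto simp: peval_add)

lemma annihilating_poly:
  fixes w :: "'a \<Rightarrow> 'k::field"
  assumes "supported w"
  obtains q where "q \<noteq> 0" "peval w q = 0"
proof (cases "inj_on (\<lambda>i. peval w (monom 1 i)) {..order G}")
  case False
  then obtain i j where "i \<noteq> j" "peval w (monom 1 i) = peval w (monom 1 j)"
    unfolding inj_on_def by blast
  then show ?thesis
    by (intro that[of "monom 1 i - monom 1 j"]) (auto simp: peval_diff poly_eq_iff)
next
  case inj: True
  define v where "v i = peval w (monom 1 i)" for i
  define D :: "('a \<Rightarrow> 'k) set" where "D = delta ` carrier G"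
  have "f \<in> fun_space.span D" if "supported f" for f :: "'a \<Rightarrow> 'k"
  proof -
    have "f = (\<Sum>g\<in>carrier G. scale (f g) (delta g))"
    proof (rule supported_eqI)
      fix x assume "x \<in> carrier G"
      then have "(\<Sum>g\<in>carrier G. f g * delta g x) = f x"
        using finite_carrier by (simp add: delta_def if_distrib[of "\<lambda>c. _ * c"] cong: if_cong)
      moreover have "sum h A x = (\<Sum>g\<in>A. h g x)" for h :: "'a \<Rightarrow> 'a \<Rightarrow> 'k" and A
        by (induction A rule: infinite_finite_induct) auto
      ultimately show "f x = (\<Sum>g\<in>carrier G. scale (f g) (delta g)) x" by simp
    qed (use that in auto)
    also have "\<dots> \<in> fun_space.span D"
      by (intro fun_space.span_sum fun_space.span_scale fun_space.span_base) (auto simp: D_def)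
    finally show ?thesis .
  qed
  then have "v ` {..order G} \<subseteq> fun_space.span D" by (auto simp: v_def)
  moreover have "finite D" "card D \<le> order G"
    using finite_carrier by (auto simp: D_def Coset.order_def card_image_le)
  moreover have "card (v ` {..order G}) = Suc (order G)"
    using inj by (simp add: v_def card_image)
  ultimately have "fun_space.dependent (v ` {..order G})"
    using fun_space.independent_span_bound[of D "v ` {..order G}"] by auto
  then obtain u where u: "\<exists>f\<in>v ` {..order G}. u f \<noteq> 0" "(\<Sum>f\<in>v ` {..order G}. scale (u f) f) = 0"
    by (auto simp: fun_space.dependent_finite)
  define q where "q = (\<Sum>i \<le> order G. monom (u (v i)) i)"
  have "poly.coeff q i = u (v i)" if "i \<le> order G" for i
    using that by (simp add: q_def coeff_sum)
  then have "q \<noteq> 0" using u(1) by (metis (no_types, lifting) atMost_iff imageE coeff_0)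
  have "peval w q = (\<Sum>i \<le> order G. peval w (monom (u (v i)) i))"
    by (simp add: q_def peval_sum)
  also have "\<dots> = (\<Sum>i \<le> order G. scale (u (v i)) (v i))"
    by (simp add: v_def smult_monom flip: peval_smult)
  also have "\<dots> = 0"
  proof -
    have "inj_on v {..order G}" using inj by (simp add: inj_on_def v_def)
    then show ?thesis using u(2) by (subst (asm) sum.reindex) auto
  qed
  finally show ?thesis using \<open>q \<noteq> 0\<close> that by blast
qed

text \<open>The adjoint for the inner product of \<open>\<complex>[G]\<close> in which the group elements are orthonormal. The
  coefficient of \<open>adj f \<star> f\<close> at the identity is the squared norm of \<open>f\<close>.\<close>

definition adj :: "('a \<Rightarrow> complex) \<Rightarrow> 'a \<Rightarrow> complex" where
  "adj f = cnj \<circ> star f"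

lemma adj_conv: "adj (f \<star> g) = adj g \<star> adj f"
  unfolding adj_def star_conv by (rule conv_map) auto

lemma supported_adj [simp, intro]: "supported (adj f)"
  by (auto simp: supported_def adj_def star_def)

lemma adj_adj [simp]: "supported f \<Longrightarrow> adj (adj f) = f"
  by (auto simp: supported_def adj_def star_def fun_eq_iff)

lemma class_fun_adj [intro]:
  assumes "class_fun f" shows "class_fun (adj f)"
  using class_fun_star[OF assms] by (auto simp: class_fun_def adj_def supported_def)

lemma adj_scale: "adj (scale c f) = scale (cnj c) (adj f)"
  by (auto simp: adj_def star_def fun_eq_iff)

lemma adj_conv_one: "(adj f \<star> f) \<one> = of_real (\<Sum>y\<in>carrier G. (cmod (f y))\<^sup>2)"
proof -
  have "(adj f \<star> f) \<one> = (\<Sum>y\<in>carrier G. cnj (f (inv y)) * f (inv y))"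
    by (simp add: conv_one adj_def star_def)
  also have "\<dots> = (\<Sum>y\<in>carrier G. cnj (f y) * f y)" by (rule sum_inv)
  finally show ?thesis by (simp add: complex_norm_square[symmetric] mult.commute del: of_real_power)
qed

lemma adj_conv_one_pos:
  assumes "supported f" "f \<noteq> 0"
  shows "(\<Sum>y\<in>carrier G. (cmod (f y))\<^sup>2) > 0"
proof -
  obtain y where "y \<in> carrier G" "f y \<noteq> 0"
    using assms unfolding supported_def by (metis ext zero_fun_apply)
  then show ?thesis
    using finite_carrier by (intro sum_pos2) auto
qed

text \<open>Take a nonzero polynomial \<open>q\<close> of least degree with \<open>q d\<close> annihilating \<open>w\<close>, and a root \<open>z\<close> of \<open>q\<close>.
  Dividing \<open>q d\<close> by the linear factor of \<open>z\<close> gives a polynomial whose value \<open>e\<close> at \<open>w\<close> is a nonzero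
  eigenvector, and \<open>F = adj e \<star> e\<close> is a self-adjoint one. Being a polynomial in \<open>w\<close>, the element \<open>e\<close>
  acts on \<open>F\<close> as a scalar \<open>k\<close>, so that \<open>F\<close> is an idempotent up to the factor \<open>k * cnj k\<close>. This factor
  is nonzero because \<open>F\<close> has positive norm, and therefore \<open>d\<close> does not vanish at \<open>z\<close>.\<close>

lemma eigen_idempotent:
  assumes w: "class_fun w" "adj w = w" and d: "peval w d \<noteq> 0"
  obtains E t where "class_fun E" "E \<star> E = E" "E \<one> \<noteq> 0" "w \<star> E = scale (of_real t) E" "poly d (of_real t) \<noteq> 0"
proof -
  define P where "P q \<longleftrightarrow> q \<noteq> 0 \<and> peval w (q * d) = 0" for q
  obtain q0 where "P q0"
    using annihilating_poly[of w] w by (metis P_def class_fun_supported conv_zero(1) peval_mult)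
  then obtain q where q: "P q" "\<And>p. P p \<Longrightarrow> degree q \<le> degree p"
    using ex_has_least_nat[of P q0 degree] by blast
  have "degree q > 0"
  proof (rule ccontr)
    assume "\<not> degree q > 0"
    then obtain c where c: "q = [:c:]" by (metis degree_eq_zeroE neq0_conv)
    then have "c \<noteq> 0" using q by (auto simp: P_def)
    have "scale c (peval w d) = 0" using q(1) by (auto simp: c P_def peval_smult)
    then have "scale (inverse c) (scale c (peval w d)) = 0" by (metis scale_simps(3))
    then show False using \<open>c \<noteq> 0\<close> d by auto
  qed
  then obtain z where "poly q z = 0"
    using fundamental_theorem_of_algebra_alt[of q] by (metis degree_pCons_0 less_numeral_extra(3))
  then obtain s where s: "q = [:-z, 1:] * s" by (metis dvdE poly_eq_0_iff_dvd)
  define a where "a = s * d"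
  define e where "e = peval w a"
  have s0: "s \<noteq> 0" using q s by (auto simp: P_def)
  then have "degree s < degree q" unfolding s by (simp add: degree_mult_eq del: mult_pCons_left)
  then have e0: "e \<noteq> 0" using q(2)[of s] s0 by (auto simp: P_def e_def a_def)
  have "[:-z, 1:] * a = q * d" by (simp add: a_def s mult.assoc del: mult_pCons_left)
  then have "peval w ([:-z, 1:] * a) = 0" using q(1) by (simp add: P_def)
  then have "scale (-z) e + w \<star> e = 0"
    by (simp only: mult_pCons_left peval_add peval_smult peval_pCons mult_zero_left pCons_0_0
        add_0_right smult_1_left e_def scale_simps add_0_left)
  then have we: "w \<star> e = scale z e"
    by (simp add: add_eq_0_iff2 fun_eq_iff)
  have ce: "class_fun e" using w by (auto simp: e_def)
  define F where "F = adj e \<star> e"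
  have cF: "class_fun F" using ce by (auto simp: F_def)
  have wF: "w \<star> F = scale z F"
    unfolding F_def by (metis we w(1) class_fun_commute conv_assoc conv_scale(2))
  have F0: "F \<noteq> 0"
    using adj_conv_one[of e] adj_conv_one_pos[of e] e0 ce 
    by (metis F_def class_fun_supported less_irrefl of_real_eq_0_iff zero_fun_apply)
  have aF: "adj F = F" using ce by (simp add: F_def adj_conv)
  define k where "k = poly a z"
  have eF: "e \<star> F = scale k F"
    using peval_eigen[OF wF] cF by (simp add: e_def k_def)
  have "F \<star> e = scale k F" using eF by (metis class_fun_commute[OF cF])
  then have "adj (F \<star> e) = scale (cnj k) (adj F)" by (simp only: adj_scale)
  then have "adj e \<star> F = scale (cnj k) F" by (simp only: adj_conv aF)
  then have FF: "F \<star> F = scale (k * cnj k) F"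
    unfolding F_def conv_assoc using eF[unfolded F_def] by simp
  have F1: "F \<one> \<noteq> 0"
    using adj_conv_one[of e] adj_conv_one_pos[of e] e0 ce
    by (metis F_def class_fun_supported less_irrefl of_real_eq_0_iff)
  have "(F \<star> F) \<one> \<noteq> 0"
    using adj_conv_one[of F] adj_conv_one_pos[of F] F0 cF aF
    by (metis class_fun_supported less_irrefl of_real_eq_0_iff)
  then have k0: "k \<noteq> 0" using FF by auto
  \<comment> \<open>self-adjointness forces the eigenvalue to be real\<close>
  have "scale (cnj z) F = adj (w \<star> F)" by (simp add: wF adj_scale aF)
  also have "\<dots> = F \<star> w" by (simp add: adj_conv w aF)
  also have "\<dots> = scale z F" using wF by (metis class_fun_commute[OF cF])
  finally have "cnj z * F \<one> = z * F \<one>" by (metis scale_apply)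
  then have "cnj z = z" using F1 by simp
  then have zr: "z = of_real (Re z)" by (simp add: complex_eq_iff)
  show thesis
  proof (rule that[of "scale (1 / (k * cnj k)) F" "Re z"])
    show "poly d (of_real (Re z)) \<noteq> 0" using k0 zr by (auto simp: k_def a_def)
    show "w \<star> scale (1 / (k * cnj k)) F = scale (of_real (Re z)) (scale (1 / (k * cnj k)) F)"
      using zr by (simp add: wF mult.commute)
  qed (use cF FF F1 k0 in auto)
qed

end

section \<open>Residues modulo powers of three\<close>

lemma power_three_pow:
  fixes t :: int
  assumes "t mod 3 = 1" "t mod 9 \<noteq> 1"
  shows "\<exists>c. t ^ 3 ^ m = 1 + 3 ^ Suc m * c \<and> \<not> 3 dvd c"
proof (induction m)
  case 0
  have "t = 1 + 3 * (t div 3)" using assms by presburger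
  moreover have "\<not> 3 dvd t div 3" using assms by presburger
  ultimately show ?case by (intro exI[of _ "t div 3"]) auto
next
  case (Suc m)
  then obtain c where c: "t ^ 3 ^ m = 1 + 3 ^ Suc m * c" "\<not> 3 dvd c" by blast
  have "t ^ 3 ^ Suc m = (t ^ 3 ^ m) ^ 3" by (simp add: mult.commute flip: power_mult)
  also have "\<dots> = (1 + 3 * 3 ^ m * c) ^ 3" by (simp add: c)
  also have "\<dots> = 1 + 3 ^ Suc (Suc m) * (c + 3 * (3 ^ m * c\<^sup>2 + 3 ^ m * 3 ^ m * c ^ 3))"
    by (simp add: algebra_simps power2_eq_square power3_eq_cube)
  finally show ?case using c(2) by (metis dvd_add_left_iff dvd_triv_left)
qed

text \<open>By induction on \<open>n\<close>: a power of \<open>t\<close> that agrees with \<open>s\<close> modulo \<open>3 ^ n\<close> is corrected to one that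
  agrees modulo \<open>3 ^ (n + 1)\<close> by the powers of \<open>t\<close> that are \<open>1\<close> modulo \<open>3 ^ n\<close>.\<close>

lemma one_mod_three_generator:
  fixes t s :: int
  assumes t: "t mod 3 = 1" "t mod 9 \<noteq> 1" and s: "s mod 3 = 1"
  shows "\<exists>k. [t ^ k = s] (mod 3 ^ n)"
proof (induction n)
  case (Suc n)
  show ?case
  proof (cases n)
    case 0
    then show ?thesis using s by (intro exI[of _ 0]) (simp add: cong_def)
  next
    case (Suc m)
    from Suc.IH obtain k where k: "[t ^ k = s] (mod 3 ^ n)" by blast
    then obtain d where d: "s = t ^ k + 3 ^ n * d"
      by (metis cong_iff_lin)
    obtain c where c: "t ^ 3 ^ m = 1 + 3 ^ n * c" "\<not> 3 dvd c"
      using power_three_pow[OF t, of m] Suc by auto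
    have "[t ^ k = 1] (mod 3)"
      using cong_pow[of t 1 3 k] t by (simp add: cong_def)
    then obtain r where r: "t ^ k = 1 + 3 * r" by (metis cong_iff_lin cong_sym)
    \<comment> \<open>multiplying by \<open>t ^ 3 ^ m\<close> once adds \<open>c * 3 ^ n\<close> to the residue\<close>
    have step: "[t ^ k * (t ^ 3 ^ m) ^ e = t ^ k + 3 ^ n * (c * int e)] (mod 3 ^ Suc n)" for e
    proof (induction e)
      case (Suc e)
      have "[t ^ k * (t ^ 3 ^ m) ^ Suc e = (t ^ k + 3 ^ n * (c * int e)) * (1 + 3 ^ n * c)] (mod 3 ^ Suc n)"
        using cong_mult[OF Suc.IH cong_refl[of "t ^ 3 ^ m"]] c by (simp add: mult_ac)
      also have "(t ^ k + 3 ^ n * (c * int e)) * (1 + 3 ^ n * c)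
          = t ^ k + 3 ^ n * (c * int (Suc e)) + 3 ^ Suc n * (r * c + 3 ^ m * (c\<^sup>2 * int e))"
        using Suc \<open>n = Suc m\<close> by (simp add: r algebra_simps power2_eq_square)
      also have "[\<dots> = t ^ k + 3 ^ n * (c * int (Suc e))] (mod 3 ^ Suc n)"
        by (simp add: cong_def)
      finally show ?case .
    qed simp
    \<comment> \<open>\<open>c\<close> is its own inverse modulo \<open>3\<close>, so \<open>e\<close> solves \<open>c * e = d\<close> modulo \<open>3\<close>\<close>
    define e where "e = nat ((c * d) mod 3)"
    have ie: "int e = (c * d) mod 3" by (simp add: e_def)
    have "3 dvd c * int e - d"
    proof -
      have "3 dvd c - 1 \<or> 3 dvd c + 1" using c(2) by presburger
      then have "3 dvd (c - 1) * (c + 1) * d" by auto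
      moreover have "c * int e - d = (c - 1) * (c + 1) * d - 3 * ((c * d) div 3 * c)"
        unfolding ie by (simp only: minus_mult_div_eq_mod[symmetric]) (simp add: algebra_simps)
      ultimately show ?thesis by (metis dvd_diff dvd_triv_left)
    qed
    then have "3 ^ n * 3 dvd 3 ^ n * (c * int e - d)" by (rule mult_dvd_mono[OF dvd_refl])
    then have "[t ^ k + 3 ^ n * (c * int e) = s] (mod 3 ^ Suc n)"
      by (simp add: d cong_iff_dvd_diff algebra_simps)
    with step[of e] have "[t ^ k * (t ^ 3 ^ m) ^ e = s] (mod 3 ^ Suc n)" by (rule cong_trans)
    then have "[t ^ (k + 3 ^ m * e) = s] (mod 3 ^ Suc n)" by (simp add: power_add power_mult)
    then show ?thesis by blast
  qed
qed simp

corollary one_mod_three_generator_nat: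
  fixes t s :: nat
  assumes "t mod 3 = 1" "t mod 9 \<noteq> 1" and "s mod 3 = 1"
  shows "\<exists>k. [t ^ k = s] (mod 3 ^ n)"
proof -
  have "int t mod 3 = 1" "int t mod 9 \<noteq> 1" "int s mod 3 = 1" 
    using assms by (simp_all flip: of_nat_mod[of _ "3", simplified] of_nat_mod[of _ "9", simplified])
  from one_mod_three_generator[OF this, of n] obtain k where "[int t ^ k = int s] (mod 3 ^ n)" by blast
  then have "[int (t ^ k) = int s] (mod int (3 ^ n))" by simp
  then show ?thesis unfolding cong_int_iff by blast
qed

section \<open>Triviality of central units\<close>

lemma common_denominator:
  assumes "finite S" "S \<subseteq> (\<rat> :: complex set)"
  shows "\<exists>D>0. \<forall>x\<in>S. of_nat D * x \<in> \<int>"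
  using assms
proof (induction S rule: finite_induct)
  case (insert x S)
  then obtain D where D: "D > 0" "\<forall>y\<in>S. of_nat D * y \<in> \<int>" by auto
  have "x \<in> \<rat>" using insert by auto
  then obtain a b where "b > 0" "x = of_int a / of_int b" by (rule Rats_cases')
  then have bx: "of_nat (nat b) * x = of_int a" by auto
  have "of_nat (nat b * D) * y \<in> \<int>" if "y \<in> insert x S" for y
  proof (cases "y = x")
    case True
    have "of_nat (nat b * D) * y = of_nat D * of_int a"
      unfolding bx[symmetric] by (simp add: True)
    then show ?thesis by (metis Ints_mult Ints_of_int Ints_of_nat)
  next
    case False
    then have "of_nat D * y \<in> \<int>" using D that by blast
    then have "of_nat (nat b) * (of_nat D * y) \<in> \<int>" by (rule Ints_mult[OF Ints_of_nat])
    then show ?thesis by (simp only: of_nat_mult mult.assoc)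
  qed
  then show ?case using D \<open>b > 0\<close> by (intro exI[of _ "nat b * D"]) auto
qed auto

lemma sum_lessThan_add:
  fixes h :: "nat \<Rightarrow> 'b::comm_monoid_add"
  shows "(\<Sum>j<a + b. h j) = (\<Sum>j<a. h j) + (\<Sum>j<b. h (a + j))"
  by (induction b) (auto simp: add_ac)

lemma sum_squares_eq_one:
  fixes u :: "'a \<Rightarrow> int"
  assumes "finite S" "(\<Sum>y\<in>S. (u y)\<^sup>2) = 1"
  obtains z where "z \<in> S" "u z = 1 \<or> u z = -1" "\<And>y. y \<in> S \<Longrightarrow> y \<noteq> z \<Longrightarrow> u y = 0"
proof -
  obtain z where z: "z \<in> S" "u z \<noteq> 0"
    using assms by (metis (mono_tags, lifting) sum.neutral zero_neq_one zero_power2)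
  have *: "(u z)\<^sup>2 + (\<Sum>y\<in>S - {z}. (u y)\<^sup>2) = 1" using assms z by (simp add: sum.remove)
  have nn: "(\<Sum>y\<in>S - {z}. (u y)\<^sup>2) \<ge> 0" by (rule sum_nonneg) auto
  have z1: "(u z)\<^sup>2 \<ge> 1" using z(2) by (simp add: int_one_le_iff_zero_less)
  then have "(u z)\<^sup>2 = 1" "(\<Sum>y\<in>S - {z}. (u y)\<^sup>2) = 0" using * nn by linarith+
  then show thesis using z assms
    by (intro that[of z]) (auto simp: sum_nonneg_eq_0_iff power2_eq_1_iff)
qed

context finite_group
begin

text \<open>Raising to a power prime to the group order permutes the group.\<close>

lemma sum_power_reindex:
  fixes f E :: "'a \<Rightarrow> 'k::comm_ring_1"
  assumes ord: "order G = 3 ^ n" and j: "\<not> 3 dvd (j::nat)"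
    and f: "\<And>g. g \<in> carrier G \<Longrightarrow> f (g [^] j) = f g"
  shows "(\<Sum>g\<in>carrier G. f g * E (g [^] j)) = (\<Sum>g\<in>carrier G. f g * E g)"
proof -
  have "normalization_semidom_class.prime (3::nat)" by simp
  then have "coprime j (order G)"
    using j ord by (metis coprime_commute coprime_power_left_iff prime_imp_coprime)
  then obtain i where i: "[j * i = 1] (mod order G)" using cong_solve_coprime_nat by auto
  then have ji: "(g [^] j) [^] i = g" "(g [^] i) [^] j = g" if "g \<in> carrier G" for g
    using pow_cong[OF that i] that by (simp_all add: nat_pow_pow mult.commute)
  have "(\<Sum>g\<in>carrier G. f g * E (g [^] j)) = (\<Sum>g\<in>carrier G. f (g [^] j) * E (g [^] j))"
    using f by simp
  also have "\<dots> = (\<Sum>g\<in>carrier G. f g * E g)"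
    by (rule sum.reindex_bij_witness[of _ "\<lambda>g. g [^] i" "\<lambda>g. g [^] j"]) (auto simp: ji)
  finally show ?thesis .
qed

text \<open>Averaging the reindexed sums over all \<open>j\<close> prime to \<open>3\<close> replaces each value of \<open>E\<close> by a sum of \<open>E\<close>
  over three full cycles of powers minus the sum over those whose exponent is divisible by \<open>3\<close>. The
  exponents run up to \<open>3 * order G\<close>, so that their number is divisible by \<open>3\<close> even for the trivial
  group; twice the group order of them are prime to \<open>3\<close>.\<close>

lemma sum_power_invariant:
  fixes f E :: "'a \<Rightarrow> complex"
  assumes ord: "order G = 3 ^ n"
    and f: "\<And>g j. g \<in> carrier G \<Longrightarrow> \<not> 3 dvd j \<Longrightarrow> f (g [^] (j::nat)) = f g"
  defines "R \<equiv> \<lambda>g. \<Sum>j < order G. E (g [^] j)"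
  shows "of_nat (2 * order G) * (\<Sum>g\<in>carrier G. f g * E g)
    = (\<Sum>g\<in>carrier G. f g * (3 * R g - R (g [^] (3::nat))))"
proof -
  define N where "N = order G"
  define J where "J = {j. j < 3 * N \<and> \<not> 3 dvd j}"
  have split: "{..<3 * N} = J \<union> (*) 3 ` {..<N}" "J \<inter> (*) 3 ` {..<N} = {}" "finite J"
    by (auto simp: J_def)
  have "card {..<3 * N} = card J + card ((*) 3 ` {..<N})"
    unfolding split(1) by (rule card_Un_disjoint) (use split in auto)
  then have cardJ: "card J = 2 * N" by (simp add: card_image inj_on_def)
  have J: "(\<Sum>j\<in>J. E (g [^] j)) = 3 * R g - R (g [^] (3::nat))" if g: "g \<in> carrier G" for g
  proof -
    have "(\<Sum>j<3 * N. E (g [^] j)) = (\<Sum>j\<in>J. E (g [^] j)) + (\<Sum>j\<in>(*) 3 ` {..<N}. E (g [^] j))"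
      unfolding split(1) by (rule sum.union_disjoint) (use split in auto)
    also have "(\<Sum>j\<in>(*) 3 ` {..<N}. E (g [^] j)) = R (g [^] (3::nat))"
      using g by (subst sum.reindex) (auto simp: R_def N_def nat_pow_pow inj_on_def)
    finally have 1: "(\<Sum>j<3 * N. E (g [^] j)) = (\<Sum>j\<in>J. E (g [^] j)) + R (g [^] (3::nat))" .
    have per: "g [^] (N + j) = g [^] j" for j
      by (rule pow_cong) (use g in \<open>auto simp: N_def cong_def\<close>)
    have "(\<Sum>j<N + (N + N). E (g [^] j)) = R g + (R g + R g)"
      unfolding sum_lessThan_add per by (simp add: R_def N_def)
    moreover have "3 * N = N + (N + N)" by simp
    moreover have "R g + (R g + R g) = 3 * R g" by simp
    ultimately have "(\<Sum>j<3 * N. E (g [^] j)) = 3 * R g" by (simp only:)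
    with 1 show ?thesis by simp
  qed
  have "of_nat (2 * N) * (\<Sum>g\<in>carrier G. f g * E g)
      = (\<Sum>j\<in>J. \<Sum>g\<in>carrier G. f g * E (g [^] j))"
    using sum_power_reindex[OF ord, of _ f E] f by (simp add: J_def flip: cardJ)
  also have "\<dots> = (\<Sum>g\<in>carrier G. f g * (\<Sum>j\<in>J. E (g [^] j)))"
    by (subst sum.swap) (simp add: sum_distrib_left)
  finally show ?thesis using J by (simp add: N_def)
qed

lemma star_fixed_conv_one:
  assumes "star f = f"
  shows "(f \<star> E) \<one> = (\<Sum>g\<in>carrier G. f g * E g)"
proof -
  have "f (inv g) = f g" if "g \<in> carrier G" for g using fun_cong[OF assms, of g] that by (simp add: star_def)
  then have "(f \<star> E) \<one> = (\<Sum>g\<in>carrier G. f (inv g) * E (inv g))" by (simp add: conv_one)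
  also have "\<dots> = (\<Sum>g\<in>carrier G. f g * E g)" by (rule sum_inv)
  finally show ?thesis .
qed

text \<open>The hypothesis on squares and the symmetry of \<open>f\<close> under inversion make \<open>f\<close> invariant under
  squaring. The powers of \<open>4\<close> already cover the exponents congruent to \<open>1\<close> modulo \<open>3\<close>, and squaring
  carries the remaining ones to these.\<close>

lemma class_fun_power_invariant:
  assumes f: "class_fun f" "star f = f" and ord: "order G = 3 ^ n"
    and cond: "\<forall>x\<in>carrier G. conjugate G (x [^] (2::nat)) (inv x)"
    and g: "g \<in> carrier G" and j: "\<not> 3 dvd (j::nat)"
  shows "f (g [^] j) = f g"
proof -
  have finv: "f (inv x) = f x" if "x \<in> carrier G" for x
    using fun_cong[OF f(2), of x] that by (simp add: star_def)
  have two: "f (x [^] (2::nat)) = f x" if x: "x \<in> carrier G" for x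
  proof -
    obtain y where "y \<in> carrier G" "inv x = y \<otimes> x [^] (2::nat) \<otimes> inv y"
      using cond x by (auto simp: conjugate_def)
    then have "f (inv x) = f (x [^] (2::nat))" by (metis class_funD[OF f(1)] nat_pow_closed x)
    then show ?thesis using finv[OF x] by simp
  qed
  have "f (x [^] (4::nat)) = f ((x [^] (2::nat)) [^] (2::nat))" if "x \<in> carrier G" for x
    using that by (simp add: nat_pow_pow)
  then have four: "f (x [^] (4::nat)) = f x" if "x \<in> carrier G" for x using that two by simp
  have fours: "f (x [^] (4 ^ k :: nat)) = f x" if x: "x \<in> carrier G" for k x
  proof (induction k)
    case (Suc k)
    have "x [^] (4 ^ Suc k :: nat) = (x [^] (4 ^ k :: nat)) [^] (4::nat)"
      using x by (simp add: nat_pow_pow mult.commute)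
    then show ?case using Suc four x by simp
  qed (use x in simp)
  have one: "f (x [^] i) = f x" if x: "x \<in> carrier G" and i: "i mod 3 = 1" for x and i :: nat
  proof -
    obtain k where "[4 ^ k = i] (mod order G)"
      using one_mod_three_generator_nat[of 4 i n] i ord by auto
    from pow_cong[OF x this] show ?thesis using fours[OF x, of k] by simp
  qed
  show ?thesis
  proof (cases "j mod 3 = 1")
    case False
    then have "(j * 2) mod 3 = 1" using j by presburger
    then have "f (g [^] (j * 2)) = f g" by (rule one[OF g])
    then show ?thesis using two[of "g [^] j"] g by (simp add: nat_pow_pow)
  qed (use one g in auto)
qed

text \<open>All powers of \<open>w\<close> have the symmetries of \<open>w\<close>. So the numbers \<open>t ^ m\<close>, multiplied by a constant that
  does not depend on \<open>m\<close>, are nonzero integers and cannot tend to \<open>0\<close>.\<close>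

lemma eigenvalue_norm_ge_one:
  fixes w :: "'a \<Rightarrow> int" and E :: "'a \<Rightarrow> complex"
  assumes ord: "order G = 3 ^ n"
    and cond: "\<forall>x\<in>carrier G. conjugate G (x [^] (2::nat)) (inv x)"
    and w: "class_fun w" "star w = w"
    and E: "class_fun E" "E \<star> E = E" "E \<one> \<noteq> 0"
    and wE: "(of_int \<circ> w) \<star> E = scale t E" and "t \<noteq> 0"
  shows "cmod t \<ge> 1"
proof (rule ccontr)
  assume "\<not> cmod t \<ge> 1"
  define R where "R g = (\<Sum>j < order G. E (g [^] j))" for g
  have "R ` carrier G \<subseteq> \<rat>"
    using cyclic_sum_rational[OF E(1,2)] by (intro image_subsetI) (simp only: R_def)
  then obtain D where D: "D > 0" "\<And>g. g \<in> carrier G \<Longrightarrow> of_nat D * R g \<in> \<int>"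
    using common_denominator[of "R ` carrier G"] finite_carrier by auto
  define K where "K = D * (2 * order G)"
  have K: "K > 0" using D order_pos by (simp add: K_def)
  have integral: "of_nat K * ((of_int \<circ> f) \<star> E) \<one> \<in> \<int>"
    if f: "class_fun f" "star f = f" for f :: "'a \<Rightarrow> int"
  proof -
    define F :: "'a \<Rightarrow> complex" where "F = of_int \<circ> f"
    have sF: "star F = F" using fun_cong[OF f(2)] by (auto simp: F_def star_def fun_eq_iff) (metis of_int_0)+
    have "of_nat (2 * order G) * (F \<star> E) \<one> = (\<Sum>g\<in>carrier G. F g * (3 * R g - R (g [^] (3::nat))))"
      unfolding star_fixed_conv_one[OF sF] R_def
      by (rule sum_power_invariant[OF ord])
        (simp add: F_def class_fun_power_invariant[OF f ord cond])
    then have "of_nat K * (F \<star> E) \<one>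
        = (\<Sum>g\<in>carrier G. of_int (f g) * (3 * (of_nat D * R g) - of_nat D * R (g [^] (3::nat))))"
      by (simp add: K_def F_def mult.assoc sum_distrib_left) (simp add: algebra_simps)
    also have "\<dots> \<in> \<int>"
    proof (rule Ints_sum)
      fix g assume "g \<in> carrier G"
      then have "of_nat D * R g \<in> \<int>" "of_nat D * R (g [^] (3::nat)) \<in> \<int>" using D(2) by auto
      then show "of_int (f g) * (3 * (of_nat D * R g) - of_nat D * R (g [^] (3::nat))) \<in> \<int>"
        by (rule Ints_mult[OF Ints_of_int Ints_diff[OF Ints_mult[OF Ints_numeral]]])
    qed
    finally show ?thesis by (simp add: F_def)
  qed
  have "\<exists>f::'a \<Rightarrow> int. class_fun f \<and> star f = f \<and> (of_int \<circ> f) \<star> E = scale (t ^ m) E" for m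
  proof (induction m)
    case 0
    have "of_int \<circ> delta \<one> = (delta \<one> :: 'a \<Rightarrow> complex)" by (auto simp: delta_def)
    then show ?case using E by (intro exI[of _ "delta \<one>"]) auto
  next
    case (Suc m)
    then obtain f :: "'a \<Rightarrow> int"
      where f: "class_fun f" "star f = f" "(of_int \<circ> f) \<star> E = scale (t ^ m) E" by blast
    have "star (w \<star> f) = w \<star> f" using w f by (simp add: star_conv class_fun_commute[OF f(1)])
    moreover have "(of_int \<circ> (w \<star> f)) \<star> E = scale (t ^ Suc m) E"
    proof -
      have "of_int \<circ> (w \<star> f) = (of_int \<circ> w) \<star> (of_int \<circ> f :: 'a \<Rightarrow> complex)" by (rule conv_map) auto
      then show ?thesis by (simp add: conv_assoc f wE mult.commute)
    qed
    moreover have "class_fun (w \<star> f)" using w f by blast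
    ultimately show ?case by blast
  qed
  have int: "of_nat K * (t ^ m * E \<one>) \<in> \<int>" for m
  proof -
    obtain f :: "'a \<Rightarrow> int"
      where f: "class_fun f" "star f = f" "(of_int \<circ> f) \<star> E = scale (t ^ m) E"
      using \<open>\<And>m. \<exists>f::'a \<Rightarrow> int. class_fun f \<and> star f = f \<and> (of_int \<circ> f) \<star> E = scale (t ^ m) E\<close>
      by blast
    from integral[OF f(1,2)] show ?thesis unfolding f(3) scale_apply .
  qed
  have "1 \<le> real K * cmod (E \<one>) * cmod t ^ m" for m
  proof -
    obtain a where a: "of_nat K * (t ^ m * E \<one>) = of_int a" using int[of m] by (auto elim: Ints_cases)
    then have "a \<noteq> 0" using K E \<open>t \<noteq> 0\<close> by auto
    then have "1 \<le> cmod (of_int a)" by simp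
    then show ?thesis unfolding a[symmetric] by (simp add: norm_mult norm_power mult_ac)
  qed
  moreover have "(\<lambda>m. real K * cmod (E \<one>) * cmod t ^ m) \<longlonglongrightarrow> real K * cmod (E \<one>) * 0"
    using \<open>\<not> cmod t \<ge> 1\<close> by (intro tendsto_intros LIMSEQ_realpow_zero) auto
  ultimately have "1 \<le> real K * cmod (E \<one>) * 0" by (intro LIMSEQ_le_const) auto
  then show False by simp
qed

text \<open>If \<open>w = u \<star> star u\<close> were not an involution, \<open>eigen_idempotent\<close> would give an eigenvalue of \<open>w\<close>
  that is real and whose square is not \<open>1\<close>. But its modulus and that of its reciprocal, an
  eigenvalue of the inverse of \<open>w\<close>, are at least \<open>1\<close>. Once \<open>w \<star> w\<close> is the identity, sums of
  squares of integers leave no room for a second coefficient of \<open>u\<close>.\<close>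

theorem central_unit_trivial:
  fixes u v :: "'a \<Rightarrow> int"
  assumes ord: "order G = 3 ^ n"
    and cond: "\<forall>x\<in>carrier G. conjugate G (x [^] (2::nat)) (inv x)"
    and u: "class_fun u" and v: "class_fun v" and uv: "u \<star> v = delta \<one>"
  shows "\<exists>z\<in>center G. u = delta z \<or> u = - delta z"
proof -
  define w where "w = u \<star> star u"
  define w' where "w' = v \<star> star v"
  have cw: "class_fun w" "class_fun w'" using u v by (auto simp: w_def w'_def)
  have sw: "star w = w" "star w' = w'" using u v by (simp_all add: w_def w'_def star_conv)
  have "w' \<star> w = v \<star> (u \<star> star u) \<star> star v"
    unfolding w_def w'_def conv_assoc by (metis class_fun_commute class_fun_star conv_assoc u)
  also have "\<dots> = (u \<star> v) \<star> star (u \<star> v)"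
    unfolding star_conv conv_assoc by (metis class_fun_commute class_fun_star conv_assoc u v)
  also have "\<dots> = delta \<one>" by (simp add: uv)
  finally have w'w: "w' \<star> w = delta \<one>" .
  define W :: "'a \<Rightarrow> complex" where "W = of_int \<circ> w"
  define W' :: "'a \<Rightarrow> complex" where "W' = of_int \<circ> w'"
  have one: "of_int \<circ> delta \<one> = (delta \<one> :: 'a \<Rightarrow> complex)" by (auto simp: delta_def)
  have cW: "class_fun W" using cw by (auto simp: W_def class_fun_def supported_def)
  have aW: "adj W = W"
    using fun_cong[OF sw(1)] by (auto simp: adj_def W_def star_def fun_eq_iff) (metis of_int_0)+
  have W'W: "W' \<star> W = delta \<one>"
    unfolding W_def W'_def one[symmetric] w'w[symmetric] by (rule conv_map[symmetric]) auto
  have WW: "W \<star> W = delta \<one>"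
  proof (rule ccontr)
    assume "W \<star> W \<noteq> delta \<one>"
    then have "peval W [:-1, 0, 1:] \<noteq> 0" using cW by (auto simp: fun_eq_iff)
    then obtain E t where E: "class_fun E" "E \<star> E = E" "E \<one> \<noteq> 0" "W \<star> E = scale (of_real t) E"
      "poly [:-1, 0, 1:] (of_real t :: complex) \<noteq> 0"
      using eigen_idempotent[OF cW aW] by metis
    have "scale (of_real t) (W' \<star> E) = W' \<star> (W \<star> E)" by (simp add: E)
    also have "\<dots> = E" by (metis W'W conv_assoc conv_one_left class_fun_supported E(1))
    finally have tE: "scale (of_real t) (W' \<star> E) = E" .
    then have t0: "t \<noteq> 0" using E(3) by auto
    then have "W' \<star> E = scale (of_real (1 / t)) (scale (of_real t) (W' \<star> E))"
      by (simp flip: of_real_mult)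
    then have "W' \<star> E = scale (of_real (1 / t)) E" using tE by simp
    then have "cmod (of_real (1 / t)) \<ge> 1"
      using t0 by (intro eigenvalue_norm_ge_one[OF ord cond cw(2) sw(2) E(1-3)]) (auto simp: W'_def)
    moreover have "cmod (of_real t) \<ge> 1"
      using t0 E by (intro eigenvalue_norm_ge_one[OF ord cond cw(1) sw(1) E(1-3)]) (auto simp: W_def)
    ultimately have "\<bar>t\<bar> = 1" using t0 by (auto simp: norm_divide field_simps)
    then have "t = 1 \<or> t = -1" by linarith
    then show False using E(5) by auto
  qed
  have "w \<star> w = delta \<one>"
  proof
    fix x
    have "of_int ((w \<star> w) x) = (W \<star> W) x"
      using conv_map[of "of_int :: int \<Rightarrow> complex" w w] by (auto simp: W_def fun_eq_iff)
    then show "(w \<star> w) x = delta \<one> x" by (auto simp: WW delta_def split: if_splits)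
  qed
  then have "(\<Sum>g\<in>carrier G. (w g)\<^sup>2) = 1"
    using star_fixed_conv_one[OF sw(1), of w] by (simp add: power2_eq_square delta_def)
  moreover have "(w \<one>)\<^sup>2 \<le> (\<Sum>g\<in>carrier G. (w g)\<^sup>2)"
    by (rule member_le_sum) (use finite_carrier in auto)
  ultimately have "w \<one> \<le> 1" by (metis abs_le_D1 abs_le_square_iff abs_one one_power2)
  have "w \<one> = (\<Sum>g\<in>carrier G. (u g)\<^sup>2)" by (simp add: w_def conv_one star_def power2_eq_square)
  moreover have "(\<Sum>g\<in>carrier G. (u g)\<^sup>2) > 0"
  proof -
    have "u \<noteq> 0" using fun_cong[OF uv, of \<one>] by (auto simp: delta_def)
    then obtain g where "g \<in> carrier G" "u g \<noteq> 0"
      using u unfolding class_fun_def supported_def by (metis ext zero_fun_apply)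
    then show ?thesis using finite_carrier by (intro sum_pos2) auto
  qed
  ultimately have "(\<Sum>g\<in>carrier G. (u g)\<^sup>2) = 1" using \<open>w \<one> \<le> 1\<close> by linarith
  then obtain z where z: "z \<in> carrier G" "u z = 1 \<or> u z = -1" "\<And>y. y \<in> carrier G \<Longrightarrow> y \<noteq> z \<Longrightarrow> u y = 0"
    using sum_squares_eq_one[OF finite_carrier] by metis
  have "z \<otimes> g = g \<otimes> z" if g: "g \<in> carrier G" for g
  proof -
    have "u (g \<otimes> z \<otimes> inv g) \<noteq> 0" using class_funD[OF u g z(1)] z(2) by auto
    then have "g \<otimes> z \<otimes> inv g = z" using z g by (metis inv_closed m_closed)
    then show ?thesis using g z(1) by (metis inv_solve_right' m_closed)
  qed
  moreover have "u = delta z \<or> u = - delta z"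
    using z u by (auto simp: class_fun_def supported_def delta_def fun_eq_iff)
  ultimately show ?thesis using z(1) by (auto simp: center_def)
qed

end

section \<open>The upper central series of a group of prime power order\<close>

context group
begin

lemma rcos_eq_iff:
  assumes "subgroup N G" "x \<in> carrier G" "y \<in> carrier G"
  shows "N #> x = N #> y \<longleftrightarrow> y \<otimes> inv x \<in> N"
  using assms by (metis is_group rcos_self repr_independence subgroup.rcos_module)

text \<open>The recursive definition only describes a central series once the previous term is known to be
  normal, so membership is unfolded under that assumption and normality is then proved by induction.\<close>

lemma upper_central_Suc_iff:
  assumes N: "upper_central G i \<lhd> G"
  shows "x \<in> upper_central G (Suc i) \<longleftrightarrow> x \<in> carrier G \<and>
    (\<forall>g\<in>carrier G. upper_central G i #> (x \<otimes> g) = upper_central G i #> (g \<otimes> x))"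
  using normal.rcos_sum[OF N]
  by (auto simp: center_def FactGroup_def RCOSETS_def)

lemma upper_central_normal: "upper_central G i \<lhd> G"
proof (induction i)
  case 0
  then show ?case by (simp add: one_is_normal)
next
  case (Suc i)
  define N where "N = upper_central G i"
  have N: "N \<lhd> G" using Suc by (simp add: N_def)
  then have sN: "subgroup N G" by (rule normal_imp_subgroup)
  have sum: "(N #> a) <#> (N #> b) = N #> (a \<otimes> b)" if "a \<in> carrier G" "b \<in> carrier G" for a b
    using normal.rcos_sum[OF N] that by blast
  have iff: "x \<in> upper_central G (Suc i) \<longleftrightarrow> x \<in> carrier G \<and>
      (\<forall>g\<in>carrier G. N #> (x \<otimes> g) = N #> (g \<otimes> x))" for x
    using upper_central_Suc_iff[OF Suc] by (simp add: N_def)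
  show ?case
    unfolding normal_inv_iff
  proof (intro conjI ballI)
    show "subgroup (upper_central G (Suc i)) G"
    proof (rule subgroupI)
      show "upper_central G (Suc i) \<subseteq> carrier G" by auto
      have "\<one> \<in> upper_central G (Suc i)" unfolding iff by simp
      then show "upper_central G (Suc i) \<noteq> {}" by blast
    next
      fix a assume "a \<in> upper_central G (Suc i)"
      then have a: "a \<in> carrier G" "\<And>g. g \<in> carrier G \<Longrightarrow> N #> (a \<otimes> g) = N #> (g \<otimes> a)"
        unfolding iff by auto
      have "N #> (inv a \<otimes> g) = N #> (g \<otimes> inv a)" if g: "g \<in> carrier G" for g
      proof -
        have "N #> (inv a \<otimes> g) = (N #> inv a) <#> (N #> (g \<otimes> a)) <#> (N #> inv a)"
          using a(1) g by (simp add: sum m_assoc)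
        also have "\<dots> = (N #> inv a) <#> (N #> (a \<otimes> g)) <#> (N #> inv a)"
          by (simp only: a(2)[OF g])
        also have "\<dots> = N #> (g \<otimes> inv a)"
          using a(1) g by (simp add: sum flip: m_assoc)
        finally show ?thesis .
      qed
      then show "inv a \<in> upper_central G (Suc i)" using a(1) unfolding iff by blast
    next
      fix a b assume "a \<in> upper_central G (Suc i)" "b \<in> upper_central G (Suc i)"
      then have a: "a \<in> carrier G" "\<And>g. g \<in> carrier G \<Longrightarrow> N #> (a \<otimes> g) = N #> (g \<otimes> a)"
        and b: "b \<in> carrier G" "\<And>g. g \<in> carrier G \<Longrightarrow> N #> (b \<otimes> g) = N #> (g \<otimes> b)"
        unfolding iff by auto
      have "N #> (a \<otimes> b \<otimes> g) = N #> (g \<otimes> (a \<otimes> b))" if g: "g \<in> carrier G" for g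
      proof -
        have "N #> (a \<otimes> b \<otimes> g) = (N #> a) <#> (N #> (b \<otimes> g))"
          using a(1) b(1) g by (simp add: sum m_assoc)
        also have "\<dots> = (N #> a) <#> (N #> (g \<otimes> b))" by (simp only: b(2)[OF g])
        also have "\<dots> = (N #> (a \<otimes> g)) <#> (N #> b)" using a(1) b(1) g by (simp add: sum m_assoc)
        also have "\<dots> = (N #> (g \<otimes> a)) <#> (N #> b)" by (simp only: a(2)[OF g])
        also have "\<dots> = N #> (g \<otimes> (a \<otimes> b))" using a(1) b(1) g by (simp add: sum m_assoc)
        finally show ?thesis .
      qed
      then show "a \<otimes> b \<in> upper_central G (Suc i)" using a(1) b(1) unfolding iff by blast
    qed
  next
    fix h a assume h: "h \<in> carrier G" and "a \<in> upper_central G (Suc i)"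
    then have a: "a \<in> carrier G" "\<And>g. g \<in> carrier G \<Longrightarrow> N #> (a \<otimes> g) = N #> (g \<otimes> a)"
      unfolding iff by auto
    have "N #> (h \<otimes> a \<otimes> inv h) = (N #> (h \<otimes> a)) <#> (N #> inv h)"
      using a(1) h by (simp add: sum)
    also have "\<dots> = (N #> (a \<otimes> h)) <#> (N #> inv h)" by (simp only: a(2)[OF h])
    also have "\<dots> = N #> a" using a(1) h by (simp add: sum m_assoc)
    finally have eq: "N #> (h \<otimes> a \<otimes> inv h) = N #> a" .
    have hah: "h \<otimes> a \<otimes> inv h \<in> carrier G" using a(1) h by simp
    have "N #> (h \<otimes> a \<otimes> inv h \<otimes> g) = N #> (g \<otimes> (h \<otimes> a \<otimes> inv h))" if g: "g \<in> carrier G" for g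
    proof -
      have "N #> (h \<otimes> a \<otimes> inv h \<otimes> g) = N #> (a \<otimes> g)"
        by (simp only: sum[OF hah g, symmetric] eq sum[OF a(1) g])
      also have "\<dots> = N #> (g \<otimes> a)" by (rule a(2)[OF g])
      also have "\<dots> = N #> (g \<otimes> (h \<otimes> a \<otimes> inv h))"
        by (simp only: sum[OF g hah, symmetric] eq sum[OF g a(1)])
      finally show ?thesis .
    qed
    then show "h \<otimes> a \<otimes> inv h \<in> upper_central G (Suc i)" using hah unfolding iff by blast
  qed
qed

lemma upper_central_subset: "upper_central G i \<subseteq> carrier G"
  using upper_central_normal normal_imp_subgroup subgroup.subset by blast

lemma upper_central_commutator:
  "x \<in> upper_central G (Suc i) \<longleftrightarrow> x \<in> carrier G \<and>
    (\<forall>g\<in>carrier G. x \<otimes> g \<otimes> inv x \<otimes> inv g \<in> upper_central G i)"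
proof -
  have "upper_central G i #> (x \<otimes> g) = upper_central G i #> (g \<otimes> x)
      \<longleftrightarrow> x \<otimes> g \<otimes> inv x \<otimes> inv g \<in> upper_central G i" if "x \<in> carrier G" "g \<in> carrier G" for g
    using that rcos_eq_iff[OF normal_imp_subgroup[OF upper_central_normal], of "g \<otimes> x" "x \<otimes> g" i]
    by (auto simp: inv_mult_group m_assoc)
  then show ?thesis unfolding upper_central_Suc_iff[OF upper_central_normal] by blast
qed

lemma upper_central_mono: "upper_central G i \<subseteq> upper_central G (Suc i)"
proof
  fix x assume x: "x \<in> upper_central G i"
  have n: "upper_central G i \<lhd> G" by (rule upper_central_normal)
  have s: "subgroup (upper_central G i) G" using n by (rule normal_imp_subgroup)
  have "x \<otimes> (g \<otimes> inv x \<otimes> inv g) \<in> upper_central G i" if "g \<in> carrier G" for g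
    using n that subgroup.m_closed[OF s x] subgroup.m_inv_closed[OF s x] unfolding normal_inv_iff by blast
  then show "x \<in> upper_central G (Suc i)"
    unfolding upper_central_commutator using x upper_central_subset by (auto simp: m_assoc subset_iff)
qed

end

context finite_group
begin

text \<open>The class equation: the sizes of the conjugacy classes are powers of \<open>p\<close> that add up to a
  multiple of \<open>p\<close>, so the identity cannot be the only class of size \<open>1\<close>.\<close>

lemma center_nontrivial:
  assumes p: "normalization_semidom_class.prime p" and ord: "order G = p ^ Suc k"
  shows "\<exists>z\<in>center G. z \<noteq> \<one>"
proof (rule ccontr)
  assume no: "\<not> ?thesis"
  define conj where "conj = (\<lambda>g. \<lambda>h \<in> carrier G. g \<otimes> h \<otimes> inv g)"
  interpret group_action G "carrier G" conj
    unfolding conj_def by (rule action_by_conjugation)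
  define orbs where "orbs = orbits G (carrier G) conj"
  have orb: "orbit G conj x = {g \<otimes> x \<otimes> inv g | g. g \<in> carrier G}" if "x \<in> carrier G" for x
    using that by (auto simp: orbit_def conj_def)
  interpret P: Congruence.partition "carrier G" orbs
    unfolding orbs_def by (rule orbit_partition)
  have part: "\<Union>orbs = carrier G" by (rule P.partition_coverture)
  have disj: "A \<inter> B = {}" if "A \<in> orbs" "B \<in> orbs" "A \<noteq> B" for A B
    using P.unique_class P.incl that by blast
  have fin: "finite orbs" "\<And>A. A \<in> orbs \<Longrightarrow> finite A"
    using part finite_carrier by (auto intro: finite_UnionD rev_finite_subset)
  have one: "{\<one>} \<in> orbs" unfolding orbs_def orbits_def
    by (auto intro!: exI[of _ \<one>] simp: orb)
  have "p dvd card A" if A: "A \<in> orbs - {{\<one>}}" for A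
  proof -
    obtain x where x: "x \<in> carrier G" "A = orbit G conj x" using A by (auto simp: orbs_def orbits_def)
    have "card A dvd p ^ Suc k"
      using orbit_stabilizer_theorem[OF x(1)] unfolding x(2) ord[symmetric] by (metis dvd_triv_left)
    then obtain i where i: "card A = p ^ i" using p by (metis divides_primepow_nat)
    have "i \<noteq> 0"
    proof
      assume "i = 0"
      then obtain y where "A = {y}" using i by (metis card_1_singletonE power_0)
      moreover have "x \<in> A" using x by (auto simp: orb intro!: exI[of _ \<one>])
      ultimately have "A = {x}" by auto
      then have "g \<otimes> x \<otimes> inv g = x" if "g \<in> carrier G" for g using x that by (auto simp: orb)
      then have "x \<in> center G" using x(1) by (auto simp: center_def) (metis inv_solve_right' m_closed)
      then show False using no \<open>A = {x}\<close> A by auto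
    qed
    then show ?thesis using i by simp
  qed
  then have "p dvd (\<Sum>A\<in>orbs - {{\<one>}}. card A)" by (rule dvd_sum)
  moreover have "p ^ Suc k = 1 + (\<Sum>A\<in>orbs - {{\<one>}}. card A)"
  proof -
    have "p ^ Suc k = card (\<Union>orbs)" using ord by (simp only: part Coset.order_def)
    also have "\<dots> = (\<Sum>A\<in>orbs. card A)"
      by (rule card_Union_disjoint) (use disj fin in \<open>auto simp: pairwise_def disjnt_def\<close>)
    also have "\<dots> = 1 + (\<Sum>A\<in>orbs - {{\<one>}}. card A)"
      using fin one by (simp add: sum.remove)
    finally show ?thesis .
  qed
  ultimately have "p dvd 1" by (metis dvd_add_left_iff dvd_power zero_less_Suc)
  then show False using p by simp
qed

lemma upper_central_strict:
  assumes p: "normalization_semidom_class.prime p" and ord: "order G = p ^ n"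
    and ne: "upper_central G i \<noteq> carrier G"
  shows "upper_central G i \<subset> upper_central G (Suc i)"
proof -
  define N where "N = upper_central G i"
  interpret N: normal N G unfolding N_def by (rule upper_central_normal)
  have fQ: "finite_group (G Mod N)"
    using N.factorgroup_is_group finite_carrier
    by (auto simp: finite_group_def finite_group_axioms_def FactGroup_def RCOSETS_def)
  have mult: "order (G Mod N) * card N = p ^ n"
    using lagrange[OF N.subgroup_axioms] ord by (simp add: Coset.order_def FactGroup_def)
  then obtain k where k: "order (G Mod N) = p ^ k"
    using p by (metis divides_primepow_nat dvd_triv_left)
  have "k \<noteq> 0"
  proof
    assume "k = 0"
    then have "card N = card (carrier G)" using mult k ord by (simp add: Coset.order_def)
    then have "N = carrier G" using N.subset finite_carrier by (metis card_subset_eq)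
    then show False using ne by (simp add: N_def)
  qed
  then obtain c where c: "c \<in> center (G Mod N)" "c \<noteq> \<one>\<^bsub>G Mod N\<^esub>"
    using finite_group.center_nontrivial[OF fQ p] k by (metis not0_implies_Suc)
  then obtain x where x: "x \<in> carrier G" "c = N #> x"
    by (auto simp: center_def FactGroup_def RCOSETS_def)
  then have "x \<in> upper_central G (Suc i)" using c by (simp add: N_def)
  moreover have "x \<notin> N"
    using c(2) x coset_join2[OF _ N.subgroup_axioms] by (auto simp: FactGroup_def)
  ultimately show ?thesis using upper_central_mono[of i] by (auto simp: N_def)
qed

lemma upper_central_reaches:
  assumes "normalization_semidom_class.prime p" "order G = p ^ n"
  obtains c where "upper_central G c = carrier G"
proof (rule ccontr)
  assume "\<not> thesis"
  then have ne: "upper_central G c \<noteq> carrier G" for c using that by blast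
  have "c \<le> card (upper_central G c)" for c
  proof (induction c)
    case (Suc c)
    have "card (upper_central G c) < card (upper_central G (Suc c))"
      using upper_central_strict[OF assms ne] finite_carrier upper_central_subset
      by (intro psubset_card_mono) (auto intro: rev_finite_subset)
    then show ?case using Suc by simp
  qed simp
  then have "Suc (order G) \<le> order G"
    using card_mono[OF finite_carrier upper_central_subset[of "Suc (order G)"]]
    by (metis Coset.order_def order_trans)
  then show False by simp
qed

end

section \<open>Exponents of the central quotients\<close>

lemma group_exponent_three:
  assumes K: "group K" and cube: "\<And>x. x \<in> carrier K \<Longrightarrow> x [^]\<^bsub>K\<^esub> (3::nat) = \<one>\<^bsub>K\<^esub>"
    and nt: "carrier K \<noteq> {\<one>\<^bsub>K\<^esub>}"
  shows "group_exponent K = 3"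
proof -
  interpret K: group K by fact
  have dvd: "K.ord x dvd 3" if "x \<in> carrier K" for x
    using K.pow_eq_id[OF that, of 3] cube[OF that] by simp
  obtain x where x: "x \<in> carrier K" "x \<noteq> \<one>\<^bsub>K\<^esub>" using nt by blast
  have "K.ord x \<noteq> 1" using x K.ord_eq_1 by blast
  moreover have "normalization_semidom_class.prime (3::nat)" by simp
  ultimately have "K.ord x = 3" using dvd[OF x(1)] by (metis prime_nat_iff)
  then have "3 dvd group_exponent K" unfolding group_exponent_def using x by (metis dvd_Lcm imageI)
  moreover have "group_exponent K dvd 3" unfolding group_exponent_def using dvd by (auto intro: Lcm_least)
  ultimately show ?thesis by (simp add: dvd_antisym)
qed

context group
begin

lemma quotient_exponent_three:
  assumes A: "subgroup A G" and B: "B \<lhd> G" and BA: "B \<subset> A"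
    and cube: "\<And>x. x \<in> A \<Longrightarrow> x [^] (3::nat) \<in> B"
  shows "group_exponent (G\<lparr>carrier := A\<rparr> Mod B) = 3"
proof (rule group_exponent_three)
  let ?A = "G\<lparr>carrier := A\<rparr>"
  interpret B: normal B ?A using normal_restrict_supergroup[OF A B] BA by blast
  have sB: "subgroup B G" using B by (rule normal_imp_subgroup)
  show "group (?A Mod B)" by (rule B.factorgroup_is_group)
  have coset: "B #>\<^bsub>?A\<^esub> x = B #> x" for x by (simp add: r_coset_def)
  show "y [^]\<^bsub>?A Mod B\<^esub> (3::nat) = \<one>\<^bsub>?A Mod B\<^esub>" if y: "y \<in> carrier (?A Mod B)" for y
  proof -
    obtain x where x: "x \<in> A" "y = B #>\<^bsub>?A\<^esub> x" using y by (auto simp: FactGroup_def RCOSETS_def)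
    then have "y [^]\<^bsub>?A Mod B\<^esub> (3::nat) = B #>\<^bsub>?A\<^esub> (x [^]\<^bsub>?A\<^esub> (3::nat))"
      unfolding x(2) by (intro B.FactGroup_pow) simp
    also have "\<dots> = B #> (x [^] (3::nat))" unfolding coset by (metis nat_pow_consistent)
    also have "\<dots> = B" using cube[OF x(1)] sB by (intro coset_join2) (auto dest: subgroup.mem_carrier)
    finally show ?thesis by (simp add: FactGroup_def)
  qed
  obtain x where x: "x \<in> A" "x \<notin> B" using BA by blast
  then have "B #> x \<noteq> B" using coset_join1[OF _ _ sB] A subgroup.mem_carrier by metis
  moreover have "B #> x \<in> carrier (?A Mod B)" using x by (auto simp: FactGroup_def RCOSETS_def coset)
  ultimately show "carrier (?A Mod B) \<noteq> {\<one>\<^bsub>?A Mod B\<^esub>}" by (auto simp: FactGroup_def)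
qed

text \<open>If \<open>x\<^sup>2 = k x\<^sup>-\<^sup>1 k\<^sup>-\<^sup>1\<close>, then \<open>x\<^sup>3 = x x\<^sup>2 = x k x\<^sup>-\<^sup>1 k\<^sup>-\<^sup>1\<close>.\<close>

lemma cube_commutator:
  assumes "x \<in> carrier G" "conjugate G (x [^] (2::nat)) (inv x)"
  obtains g where "g \<in> carrier G" "x [^] (3::nat) = x \<otimes> g \<otimes> inv x \<otimes> inv g"
proof -
  obtain h where h: "h \<in> carrier G" "inv x = h \<otimes> x [^] (2::nat) \<otimes> inv h"
    using assms by (auto simp: conjugate_def)
  then have "inv h \<otimes> inv x \<otimes> h = x [^] (2::nat)"
    using assms(1) by (simp add: m_assoc) (simp flip: m_assoc)
  moreover have "x [^] (3::nat) = x \<otimes> x [^] (2::nat)"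
    using assms(1) by (simp add: numeral_3_eq_3 numeral_2_eq_2 m_assoc)
  ultimately show thesis
    using that[of "inv h"] assms(1) h(1) by (simp add: m_assoc)
qed

lemma lower_central_one: "lower_central G 1 = carrier G"
  by (simp add: lower_central_def)

lemma lower_central_step:
  "i \<ge> 1 \<Longrightarrow> lower_central G (i + 1) = commutator_subgroup G (lower_central G i) (carrier G)"
  by (cases i) (auto simp: lower_central_def)

lemma commutator_subgroup_normal:
  assumes "H \<lhd> G"
  shows "commutator_subgroup G H (carrier G) \<lhd> G"
  unfolding commutator_subgroup_def
proof (rule normal_generateI)
  have H: "H \<subseteq> carrier G" using assms normal_imp_subgroup subgroup.subset by blast
  then show "(\<Union>h\<in>H. \<Union>k\<in>carrier G. {h \<otimes> k \<otimes> inv h \<otimes> inv k}) \<subseteq> carrier G" by auto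
  fix c g assume "c \<in> (\<Union>h\<in>H. \<Union>k\<in>carrier G. {h \<otimes> k \<otimes> inv h \<otimes> inv k})" and g: "g \<in> carrier G"
  then obtain h k where hk: "h \<in> H" "k \<in> carrier G" "c = h \<otimes> k \<otimes> inv h \<otimes> inv k" by blast
  define h' k' where "h' = g \<otimes> h \<otimes> inv g" and "k' = g \<otimes> k \<otimes> inv g"
  have "h' \<in> H" "k' \<in> carrier G" using assms hk g by (auto simp: h'_def k'_def normal_inv_iff)
  moreover have "g \<otimes> c \<otimes> inv g = h' \<otimes> k' \<otimes> inv h' \<otimes> inv k'"
    using hk g H by (auto simp: h'_def k'_def inv_mult_group m_assoc subset_iff inv_solve_left)
      (simp flip: m_assoc)
  ultimately show "g \<otimes> c \<otimes> inv g \<in> (\<Union>h\<in>H. \<Union>k\<in>carrier G. {h \<otimes> k \<otimes> inv h \<otimes> inv k})" by blast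
qed

lemma commutator_subgroup_mem:
  "h \<in> H \<Longrightarrow> k \<in> K \<Longrightarrow> h \<otimes> k \<otimes> inv h \<otimes> inv k \<in> commutator_subgroup G H K"
  unfolding commutator_subgroup_def by (rule generate.incl) blast

lemma commutator_subgroup_least:
  assumes "subgroup S G" "\<And>h k. h \<in> H \<Longrightarrow> k \<in> K \<Longrightarrow> h \<otimes> k \<otimes> inv h \<otimes> inv k \<in> S"
  shows "commutator_subgroup G H K \<subseteq> S"
  unfolding commutator_subgroup_def by (rule generate_subgroup_incl[OF _ assms(1)]) (use assms in auto)

lemma commutator_subgroup_subset:
  assumes "H \<lhd> G"
  shows "commutator_subgroup G H (carrier G) \<subseteq> H"
proof (rule commutator_subgroup_least)
  show s: "subgroup H G" using assms by (rule normal_imp_subgroup)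
  fix h k assume hk: "h \<in> H" "k \<in> carrier G"
  then have "h \<otimes> (k \<otimes> inv h \<otimes> inv k) \<in> H"
    using assms subgroup.m_closed[OF s] subgroup.m_inv_closed[OF s] unfolding normal_inv_iff by blast
  then show "h \<otimes> k \<otimes> inv h \<otimes> inv k \<in> H" using hk s subgroup.mem_carrier by (fastforce simp: m_assoc)
qed

lemma lower_central_normal: "i \<ge> 1 \<Longrightarrow> lower_central G i \<lhd> G"
proof (induction i rule: dec_induct)
  case base
  then show ?case by (simp add: lower_central_one[simplified] normal_inv_iff subgroup_self)
next
  case (step i)
  then show ?case using lower_central_step[of i] commutator_subgroup_normal by simp
qed

end

context finite_group
begin

text \<open>If the commutators of \<open>H\<close> with the group generated all of \<open>H\<close>, then \<open>H\<close> would descend through the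
  upper central series from the whole group down to the trivial subgroup.\<close>

lemma commutator_subgroup_strict:
  assumes "normalization_semidom_class.prime p" "order G = p ^ n"
    and H: "H \<lhd> G" "H \<noteq> {\<one>}"
  shows "commutator_subgroup G H (carrier G) \<subset> H"
proof (rule ccontr)
  assume "\<not> ?thesis"
  then have eq: "commutator_subgroup G H (carrier G) = H" using commutator_subgroup_subset[OF H(1)] by blast
  obtain c where c: "upper_central G c = carrier G" using upper_central_reaches assms(1,2) by blast
  have "H \<subseteq> upper_central G (c - k)" for k
  proof (induction k)
    case 0
    then show ?case using c H(1) normal_imp_subgroup subgroup.subset by fastforce
  next
    case (Suc k)
    show ?case
    proof (cases "c - k")
      case (Suc j)
      then have "commutator_subgroup G H (carrier G) \<subseteq> upper_central G j"
        using \<open>H \<subseteq> upper_central G (c - k)\<close> upper_central_commutator[of _ j]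
        by (intro commutator_subgroup_least normal_imp_subgroup[OF upper_central_normal]) auto
      then show ?thesis using Suc eq by (simp add: diff_Suc)
    qed (use Suc in \<open>simp add: diff_Suc\<close>)
  qed
  from this[of c] have "H \<subseteq> {\<one>}" by simp
  then show False using H subgroup.one_closed[OF normal_imp_subgroup[OF H(1)]] by blast
qed

lemma lower_central_quotient_exponent:
  assumes ord: "order G = 3 ^ n"
    and cond: "\<forall>x\<in>carrier G. conjugate G (x [^] (2::nat)) (inv x)"
    and i: "i \<ge> 1" "lower_central G i \<noteq> {\<one>}"
  shows "group_exponent (G\<lparr>carrier := lower_central G i\<rparr> Mod lower_central G (i + 1)) = 3"
proof (rule quotient_exponent_three)
  have three: "normalization_semidom_class.prime (3::nat)" by simp
  note N = lower_central_normal[OF i(1)]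
  show "subgroup (lower_central G i) G" using N by (rule normal_imp_subgroup)
  show "lower_central G (i + 1) \<lhd> G" by (rule lower_central_normal) simp
  show "lower_central G (i + 1) \<subset> lower_central G i"
    unfolding lower_central_step[OF i(1)] by (rule commutator_subgroup_strict[OF three ord N i(2)])
  fix x assume x: "x \<in> lower_central G i"
  then have "x \<in> carrier G" using N normal_imp_subgroup subgroup.mem_carrier by metis
  then obtain g where "g \<in> carrier G" "x [^] (3::nat) = x \<otimes> g \<otimes> inv x \<otimes> inv g"
    using cube_commutator cond by metis
  then show "x [^] (3::nat) \<in> lower_central G (i + 1)"
    unfolding lower_central_step[OF i(1)] using commutator_subgroup_mem[OF x] by simp
qed

lemma upper_central_quotient_exponent:
  assumes ord: "order G = 3 ^ n"
    and cond: "\<forall>x\<in>carrier G. conjugate G (x [^] (2::nat)) (inv x)"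
    and i: "upper_central G i \<noteq> carrier G"
  shows "group_exponent (G\<lparr>carrier := upper_central G (i + 1)\<rparr> Mod upper_central G i) = 3"
proof (rule quotient_exponent_three)
  have three: "normalization_semidom_class.prime (3::nat)" by simp
  show "subgroup (upper_central G (i + 1)) G" by (rule normal_imp_subgroup[OF upper_central_normal])
  show "upper_central G i \<lhd> G" by (rule upper_central_normal)
  show "upper_central G i \<subset> upper_central G (i + 1)"
    using upper_central_strict[OF three ord i] by simp
  fix x assume "x \<in> upper_central G (i + 1)"
  then have x: "x \<in> upper_central G (Suc i)" by simp
  then have "x \<in> carrier G" using upper_central_subset by blast
  then obtain g where "g \<in> carrier G" "x [^] (3::nat) = x \<otimes> g \<otimes> inv x \<otimes> inv g"
    using cube_commutator cond by metis
  then show "x [^] (3::nat) \<in> upper_central G i"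
    using x[unfolded upper_central_commutator] by simp
qed

end

section \<open>A unit of the integral group ring of a cyclic group\<close>

context finite_group
begin

text \<open>The cyclic subgroup generated by \<open>x\<close>; natural exponents suffice as the group is finite.\<close>

definition powers :: "'a \<Rightarrow> 'a set" where
  "powers x = {x [^] i | i :: nat. True}"

lemma inv_pow_eq: "x \<in> carrier G \<Longrightarrow> inv (x [^] i) = x [^] (i * (order G - 1))"
proof (rule inv_equality)
  assume x: "x \<in> carrier G"
  have "x [^] (i * (order G - 1)) \<otimes> x [^] i = x [^] (i * (order G - 1) + i)"
    using x by (simp add: nat_pow_mult)
  also have "i * (order G - 1) + i = order G * i"
    using order_pos by (cases "order G") auto
  also have "x [^] (order G * i) = \<one>"
    using x by (simp add: pow_order_eq_1 flip: nat_pow_pow)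
  finally show "x [^] (i * (order G - 1)) \<otimes> x [^] i = \<one>" .
qed auto

lemma subgroup_powers: "x \<in> carrier G \<Longrightarrow> subgroup (powers x) G"
proof (rule subgroupI)
  assume x: "x \<in> carrier G"
  show "powers x \<subseteq> carrier G" using x by (auto simp: powers_def)
  show "powers x \<noteq> {}" by (auto simp: powers_def)
  show "inv a \<in> powers x" if "a \<in> powers x" for a
    using that x inv_pow_eq by (auto simp: powers_def)
  show "a \<otimes> b \<in> powers x" if "a \<in> powers x" "b \<in> powers x" for a b
    using that x nat_pow_mult by (auto simp: powers_def)
qed

lemma peval_X_power:
  "x \<in> carrier G \<Longrightarrow> peval (delta x) ([:0, 1:] ^ i) = delta (x [^] i)"
  by (induction i) (simp_all only: power_Suc peval_mult peval_X supported_intros delta_mult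
      power_0 peval_one nat_pow_0 nat_pow_closed nat_pow_Suc2)

lemma peval_powers:
  fixes p :: "'k::comm_ring_1 poly"
  assumes "x \<in> carrier G" "y \<notin> powers x"
  shows "peval (delta x) p y = 0"
proof -
  have "\<forall>y. y \<notin> powers x \<longrightarrow> peval (delta x) p y = 0"
  proof (rule pCons_induct[of "\<lambda>p. \<forall>y. y \<notin> powers x \<longrightarrow> peval (delta x) p y = 0"])
    fix c and p :: "'k poly"
    assume IH: "\<forall>y. y \<notin> powers x \<longrightarrow> peval (delta x) p y = 0"
    show "\<forall>y. y \<notin> powers x \<longrightarrow> peval (delta x) (pCons c p) y = 0"
    proof (intro allI impI)
      fix y assume y: "y \<notin> powers x"
      have s: "subgroup (powers x) G" using assms by (simp add: subgroup_powers)
      have "y \<noteq> \<one>" using y subgroup.one_closed[OF s] by blast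
      moreover have "(delta x \<star> peval (delta x) p) y = 0"
      proof (cases "y \<in> carrier G")
        case True
        have "x \<in> powers x" unfolding powers_def using assms by (auto intro!: exI[of _ 1])
        then have "inv x \<otimes> y \<in> powers x \<Longrightarrow> y \<in> powers x"
          using subgroup.m_closed[OF s, of x "inv x \<otimes> y"] assms True by (simp flip: m_assoc)
        then show ?thesis using IH y True assms by (auto simp: delta_conv)
      qed (simp add: conv_def)
      ultimately show "peval (delta x) (pCons c p) y = 0" by (simp add: delta_def)
    qed
  qed simp
  then show ?thesis using assms by blast
qed

lemma peval_commute: "peval w p \<star> peval w q = peval w q \<star> peval w p"
  by (metis peval_mult mult.commute)

end

text \<open>The polynomial \<open>(1 + y\<^sup>5) / (1 + y)\<close>. Evaluated at an element of odd order prime to \<open>5\<close> it becomes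
  a unit: \<open>- y\<close> and \<open>(- y)\<^sup>5\<close> then generate the same cyclic group.\<close>

definition alternating :: "'b::comm_ring_1 \<Rightarrow> 'b" where
  "alternating y = 1 - y + y ^ 2 - y ^ 3 + y ^ 4"

text \<open>The first-order term \<open>2 (y + y\<^sup>7)\<close> modulo \<open>4\<close> is what makes the final unit nontrivial.\<close>

lemma alternating_square:
  "(alternating y)\<^sup>2 = alternating (y\<^sup>2) + 2 * (y + y ^ 7) +
    4 * (- y + y ^ 2 - y ^ 3 + y ^ 4 - y ^ 5 + y ^ 6 - y ^ 7)"
  unfolding alternating_def by (simp add: algebra_simps eval_nat_numeral)

lemma alternating_frobenius: "\<exists>r. alternating y ^ 2 ^ k = alternating (y ^ 2 ^ k) + 2 * r"
proof (induction k)
  case 0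
  show ?case by (intro exI[of _ 0]) simp
next
  case (Suc k)
  then obtain r where r: "alternating y ^ 2 ^ k = alternating (y ^ 2 ^ k) + 2 * r" by blast
  define z where "z = y ^ 2 ^ k"
  have "alternating y ^ 2 ^ Suc k = (alternating z + 2 * r)\<^sup>2"
    unfolding z_def r[symmetric] by (simp add: mult.commute flip: power_mult)
  also have "\<dots> = (alternating z)\<^sup>2 + 2 * (2 * alternating z * r + 2 * r\<^sup>2)"
    by (simp add: power2_eq_square algebra_simps)
  also have "\<dots> = alternating (z\<^sup>2) + 2 * ((z + z ^ 7) +
      2 * (- z + z ^ 2 - z ^ 3 + z ^ 4 - z ^ 5 + z ^ 6 - z ^ 7) + (2 * alternating z * r + 2 * r\<^sup>2))"
    unfolding alternating_square by (simp add: algebra_simps)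
  also have "z\<^sup>2 = y ^ 2 ^ Suc k" by (simp add: z_def mult.commute flip: power_mult)
  finally show ?case by blast
qed

text \<open>Squaring a congruence modulo \<open>2\<close> gives one modulo \<open>4\<close>, so only the last of the successive
  squarings contributes a term of first order.\<close>

lemma alternating_frobenius_mod_four:
  "\<exists>r. alternating y ^ 2 ^ Suc k
     = alternating (y ^ 2 ^ Suc k) + 2 * (y ^ 2 ^ k + y ^ (7 * 2 ^ k)) + 4 * r"
proof -
  obtain r where r: "alternating y ^ 2 ^ k = alternating (y ^ 2 ^ k) + 2 * r"
    using alternating_frobenius by blast
  define z where "z = y ^ 2 ^ k"
  have z: "z\<^sup>2 = y ^ 2 ^ Suc k" "z ^ 7 = y ^ (7 * 2 ^ k)"
    by (simp_all add: z_def mult.commute flip: power_mult)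
  have "alternating y ^ 2 ^ Suc k = (alternating z + 2 * r)\<^sup>2"
    unfolding z_def r[symmetric] by (simp add: mult.commute flip: power_mult)
  also have "\<dots> = (alternating z)\<^sup>2 + 4 * (alternating z * r + r\<^sup>2)"
    by (simp add: power2_eq_square algebra_simps)
  also have "\<dots> = alternating (z\<^sup>2) + 2 * (z + z ^ 7) +
      4 * (- z + z ^ 2 - z ^ 3 + z ^ 4 - z ^ 5 + z ^ 6 - z ^ 7 + (alternating z * r + r\<^sup>2))"
    unfolding alternating_square by (simp add: algebra_simps)
  finally show ?thesis unfolding z unfolding z_def by blast
qed

context finite_group
begin

lemma peval_of_int: "peval w (of_int c * p) = scale (of_int c) (peval w p)"
  by (simp add: of_int_poly peval_smult)

text \<open>With \<open>5 d\<close> congruent to \<open>1\<close> modulo twice the order, the inverse is \<open>(1 + x ^ (5 d)) / (1 + x\<^sup>5)\<close>,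
  which is a polynomial since \<open>d\<close> is odd. Cancelling \<open>1 + x\<close> is possible because, the order being odd,
  it divides \<open>1 + x ^ order G = 2\<close>, and \<open>2\<close> can be cancelled in integral coefficients.\<close>

lemma alternating_inverse:
  assumes x: "x \<in> carrier G" and odd: "odd (order G)" and co: "coprime 5 (order G)"
  shows "\<exists>p :: int poly. peval (delta x) (alternating [:0, 1:] * p) = delta \<one>"
proof -
  define t :: "int poly" where "t = [:0, 1:]"
  have ev: "peval (delta x) (t ^ i) = delta (x [^] i)" for i
    unfolding t_def by (rule peval_X_power[OF x])
  have "coprime 5 (2 * order G)" using co by simp
  then obtain d where d: "[5 * d = 1] (mod (2 * order G))"
    using cong_solve_coprime_nat[of 5 "2 * order G"] by auto
  then have "odd d" by (metis cong_dvd_modulus_nat cong_def dvd_triv_left even_mult_iff odd_one odd_iff_mod_2_eq_one)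
  have "[5 * d = 1] (mod order G)" using d by (rule cong_dvd_modulus_nat) simp
  from pow_cong[OF x this] have x5d: "x [^] (5 * d) = x" using x by simp
  define p where "p = (\<Sum>i<d. (- (t ^ 5)) ^ i)"
  define q where "q = (\<Sum>i < order G. (- t) ^ i)"
  have p: "(1 + t ^ 5) * p = 1 + t ^ (5 * d)"
    using one_diff_power_eq[of "- (t ^ 5)" d] \<open>odd d\<close> by (simp add: p_def power_mult)
  have q: "(1 + t) * q = 1 + t ^ order G"
    using one_diff_power_eq[of "- t" "order G"] odd by (simp add: q_def)
  have "(1 + t) * alternating t = 1 + t ^ 5"
    unfolding alternating_def by (simp add: algebra_simps eval_nat_numeral)
  then have "(1 + t) * (alternating t * p) = 1 + t ^ (5 * d)"
    using p by (simp flip: mult.assoc)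
  then have "peval (delta x) ((1 + t) * (alternating t * p)) = peval (delta x) (1 + t)"
    using ev[of 1] x5d by (simp add: peval_add ev x)
  then have "peval (delta x) (q * ((1 + t) * (alternating t * p))) = peval (delta x) (q * (1 + t))"
    by (simp add: peval_mult)
  moreover have "peval (delta x) (q * (1 + t)) = scale 2 (delta \<one>)"
    using x by (simp add: mult.commute[of q] q peval_add ev pow_order_eq_1 fun_eq_iff)
  moreover have "q * ((1 + t) * (alternating t * p)) = (q * (1 + t)) * (alternating t * p)"
    by (simp only: mult.assoc)
  ultimately have "scale 2 (delta \<one>) \<star> peval (delta x) (alternating t * p) = scale 2 (delta \<one>)"
    by (simp only: peval_mult)
  then have "scale 2 (peval (delta x) (alternating t * p)) = scale 2 (delta \<one>)" by simp
  then have "peval (delta x) (alternating t * p) = delta \<one>" by (simp add: fun_eq_iff)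
  then show ?thesis unfolding t_def by blast
qed

text \<open>Let \<open>\<beta>\<close> be the value of \<open>alternating\<close> at \<open>x\<close> and \<open>q = 2 ^ Suc k\<close>, so that \<open>x ^ q = x\<close>. The unit is
  the power of \<open>\<beta>\<close> with exponent \<open>q - 1\<close>: modulo \<open>2\<close> the Frobenius map fixes \<open>\<beta>\<close>, so \<open>\<beta> ^ q\<close> is \<open>\<beta>\<close>
  plus a known multiple of \<open>2\<close>, and dividing by \<open>\<beta>\<close> gives \<open>1 + 2 a\<close> with \<open>\<beta> a\<close> known modulo \<open>2\<close>.\<close>

lemma cyclic_unit:
  assumes x: "x \<in> carrier G" and odd: "odd (order G)" and co: "coprime 5 (order G)"
    and k: "[2 ^ Suc k = 1] (mod order G)"
  obtains p p' a r :: "int poly"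
  where "peval (delta x) p \<star> peval (delta x) p' = delta \<one>"
    and "peval (delta x) p = delta \<one> + scale 2 (peval (delta x) a)"
    and "peval (delta x) (alternating [:0, 1:]) \<star> peval (delta x) a
      = delta (x [^] (2 ^ k :: nat)) + delta (x [^] (7 * 2 ^ k :: nat)) + scale 2 (peval (delta x) r)"
proof -
  define t :: "int poly" where "t = [:0, 1:]"
  have ev: "peval (delta x) (t ^ i) = delta (x [^] i)" for i
    unfolding t_def by (rule peval_X_power[OF x])
  obtain p where p: "peval (delta x) (alternating t * p) = delta \<one>"
    using alternating_inverse[OF x odd co] unfolding t_def by blast
  define q :: nat where "q = 2 ^ Suc k"
  obtain r where r: "alternating t ^ q = alternating (t ^ q) + 2 * (t ^ 2 ^ k + t ^ (7 * 2 ^ k)) + 4 * r"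
    using alternating_frobenius_mod_four[of t k] unfolding q_def by blast
  define a where "a = p * (t ^ 2 ^ k + t ^ (7 * 2 ^ k) + 2 * r)"
  have one: "peval (delta x) ((alternating t * p) ^ m) = delta \<one>" for m
    by (induction m) (simp_all only: power_0 power_Suc peval_one peval_mult[of _ "alternating t * p"] p
        conv_one_left supported_intros one_closed)
  have pow_q: "peval (delta x) (t ^ (q * i)) = peval (delta x) (t ^ i)" for i
    unfolding ev using pow_cong[OF x, of "q * i" i] cong_scalar_right[OF k, of i] by (simp add: q_def)
  then have alt: "peval (delta x) (alternating (t ^ q)) = peval (delta x) (alternating t)"
    using pow_q[of 1] pow_q by (simp add: alternating_def peval_add peval_diff flip: power_mult)
  have two: "peval (delta x) (2 * f) = scale 2 (peval (delta x) f)" for f :: "int poly"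
    using peval_of_int[of "delta x" 2 f] by simp
  show thesis
  proof (rule that[of "p * alternating t ^ q" "alternating t * p ^ q" a r])
    have "(p * alternating t ^ q) * (alternating t * p ^ q) = (alternating t * p) ^ Suc q"
      by (simp add: power_mult_distrib mult_ac)
    then show "peval (delta x) (p * alternating t ^ q) \<star> peval (delta x) (alternating t * p ^ q) = delta \<one>"
      using one[of "Suc q"] by (simp only: peval_mult[symmetric])
    have "p * alternating t ^ q = p * alternating (t ^ q) + 2 * a"
      by (simp add: r a_def algebra_simps)
    then show "peval (delta x) (p * alternating t ^ q) = delta \<one> + scale 2 (peval (delta x) a)"
      using p by (simp only: peval_add two) (simp only: peval_mult alt mult.commute[of "alternating t" p])
    have "alternating t * a = (alternating t * p) * (t ^ 2 ^ k + t ^ (7 * 2 ^ k) + 2 * r)"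
      by (simp only: a_def mult.assoc)
    then have "peval (delta x) (alternating t) \<star> peval (delta x) a
        = peval (delta x) (alternating t * p) \<star> peval (delta x) (t ^ 2 ^ k + t ^ (7 * 2 ^ k) + 2 * r)"
      by (simp only: peval_mult[symmetric])
    then show "peval (delta x) (alternating [:0, 1:]) \<star> peval (delta x) a
      = delta (x [^] (2 ^ k :: nat)) + delta (x [^] (7 * 2 ^ k :: nat)) + scale 2 (peval (delta x) r)"
      by (simp only: t_def[symmetric] p conv_one_left supported_peval) (simp only: peval_add ev two)
  qed
qed

end

section \<open>From units of a cyclic subgroup to central units\<close>

context finite_group
begin

lemma supported_on_commute:
  assumes fH: "\<And>y. y \<notin> H \<Longrightarrow> f y = 0" and H: "H \<subseteq> carrier G"
    and g: "\<And>h. h \<in> H \<Longrightarrow> delta h \<star> g = g \<star> delta h"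
  shows "f \<star> g = g \<star> f"
proof -
  have f: "f = (\<Sum>h\<in>H. scale (f h) (delta h))"
  proof
    fix y
    have fin: "finite H" using H finite_carrier by (rule finite_subset)
    have "(\<Sum>h\<in>H. scale (f h) (delta h)) y = (\<Sum>h\<in>H. f h * delta h y)"
      using fin by (induction H rule: finite_induct) auto
    also have "\<dots> = f y"
      using fin fH by (simp add: delta_def if_distrib[of "\<lambda>c. _ * c"] cong: if_cong)
    finally show "f y = (\<Sum>h\<in>H. scale (f h) (delta h)) y" by simp
  qed
  have "(\<Sum>h\<in>H. scale (f h) (delta h)) \<star> g = g \<star> (\<Sum>h\<in>H. scale (f h) (delta h))"
    unfolding conv_sum by (rule sum.cong) (simp_all add: g)
  then show ?thesis by (simp only: f[symmetric])
qed

definition conj_by :: "'a \<Rightarrow> ('a \<Rightarrow> 'k::comm_ring_1) \<Rightarrow> 'a \<Rightarrow> 'k" where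
  "conj_by g f = delta g \<star> f \<star> delta (inv g)"

lemma conj_by_apply:
  "g \<in> carrier G \<Longrightarrow> y \<in> carrier G \<Longrightarrow> conj_by g f y = f (inv g \<otimes> y \<otimes> g)"
  by (simp add: conj_by_def conv_delta delta_conv m_assoc)

lemma supported_conj_by [simp, intro]: "supported (conj_by g f)"
  by (simp add: conj_by_def)

lemma conj_by_one [simp]: "supported f \<Longrightarrow> conj_by \<one> f = f"
  by (simp add: conj_by_def)

lemma conj_by_delta_one [simp]: "g \<in> carrier G \<Longrightarrow> conj_by g (delta \<one>) = delta \<one>"
  by (simp add: conj_by_def delta_mult)

lemma conj_by_conv:
  assumes "g \<in> carrier G"
  shows "conj_by g (f \<star> h) = conj_by g f \<star> conj_by g h"
proof -
  have "conj_by g f \<star> conj_by g h = delta g \<star> f \<star> (delta (inv g) \<star> delta g) \<star> h \<star> delta (inv g)"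
    by (simp add: conj_by_def conv_assoc)
  also have "delta (inv g) \<star> delta g = delta \<one>" using assms by (simp add: delta_mult)
  also have "delta g \<star> f \<star> delta \<one> = delta g \<star> f" by simp
  finally show ?thesis by (simp add: conj_by_def conv_assoc)
qed

lemma conj_by_conj_by:
  assumes "g \<in> carrier G" "h \<in> carrier G"
  shows "conj_by g (conj_by h f) = conj_by (g \<otimes> h) f"
proof -
  have "conj_by g (conj_by h f) = (delta g \<star> delta h) \<star> f \<star> (delta (inv h) \<star> delta (inv g))"
    by (simp add: conj_by_def conv_assoc)
  then show ?thesis using assms by (simp add: delta_mult conj_by_def inv_mult_group)
qed

lemma conj_by_eq_iff:
  assumes "g \<in> carrier G" "supported f"
  shows "conj_by g f = f \<longleftrightarrow> delta g \<star> f = f \<star> delta g"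
proof
  assume "conj_by g f = f"
  then have "f \<star> delta g = delta g \<star> f \<star> (delta (inv g) \<star> delta g)"
    by (metis conj_by_def conv_assoc)
  then show "delta g \<star> f = f \<star> delta g" using assms by (simp add: delta_mult)
next
  assume "delta g \<star> f = f \<star> delta g"
  then show "conj_by g f = f" using assms by (simp add: conj_by_def conv_assoc delta_mult)
qed

lemma conj_by_sum:
  assumes g: "g \<in> carrier G" and D: "D \<subseteq> carrier G"
    and inv: "\<And>g y. g \<in> carrier G \<Longrightarrow> y \<in> D \<Longrightarrow> g \<otimes> y \<otimes> inv g \<in> D"
  shows "(\<Sum>y\<in>D. conj_by g f y) = (\<Sum>y\<in>D. f y)"
proof -
  have inv': "inv g \<otimes> y \<otimes> g \<in> D" if "y \<in> D" for y using inv[of "inv g" y] g that by simp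
  have "(\<Sum>y\<in>D. conj_by g f y) = (\<Sum>y\<in>D. f (inv g \<otimes> y \<otimes> g))"
    using D g by (intro sum.cong) (auto simp: conj_by_apply subset_iff)
  also have "\<dots> = (\<Sum>y\<in>D. f y)"
    by (rule sum.reindex_bij_witness[of _ "\<lambda>y. g \<otimes> y \<otimes> inv g" "\<lambda>y. inv g \<otimes> y \<otimes> g"])
      (use D g inv inv' in \<open>auto simp: m_assoc subset_iff inv_solve_left\<close>, simp_all flip: m_assoc add: subset_iff)
  finally show ?thesis .
qed

text \<open>Units of the form \<open>1 + 2 a\<close>, together with the parity of the sum of \<open>a\<close> over \<open>D\<close>. This parity is
  additive under multiplication, as the product of \<open>1 + 2 a\<close> and \<open>1 + 2 e\<close> is \<open>1 + 2 (a + e)\<close> modulo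
  \<open>4\<close>, and invariant under conjugation if \<open>D\<close> is.\<close>

definition unit_with_parity :: "'a set \<Rightarrow> int \<Rightarrow> ('a \<Rightarrow> int) \<Rightarrow> bool" where
  "unit_with_parity D m b \<longleftrightarrow> (\<exists>b'. supported b' \<and> b \<star> b' = delta \<one> \<and> b' \<star> b = delta \<one>) \<and>
     (\<exists>a. supported a \<and> b = delta \<one> + scale 2 a \<and> [(\<Sum>y\<in>D. a y) = m] (mod 2))"

lemma unit_with_parity_supported: "unit_with_parity D m b \<Longrightarrow> supported b"
  by (auto simp: unit_with_parity_def)

lemma unit_with_parity_one: "unit_with_parity D 0 (delta \<one>)"
  unfolding unit_with_parity_def
  by (intro conjI exI[of _ "delta \<one>"] exI[of _ 0]) auto

lemma unit_with_parity_conv: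
  assumes b: "unit_with_parity D m b" and c: "unit_with_parity D k c"
  shows "unit_with_parity D (m + k) (b \<star> c)"
proof -
  obtain b' a where b': "b \<star> b' = delta \<one>" "b' \<star> b = delta \<one>" "supported b'"
    and a: "supported a" "b = delta \<one> + scale 2 a" "[(\<Sum>y\<in>D. a y) = m] (mod 2)"
    using b unfolding unit_with_parity_def by blast
  obtain c' e where c': "c \<star> c' = delta \<one>" "c' \<star> c = delta \<one>" "supported c'"
    and e: "supported e" "c = delta \<one> + scale 2 e" "[(\<Sum>y\<in>D. e y) = k] (mod 2)"
    using c unfolding unit_with_parity_def by blast
  have sb: "supported b" "supported c" using b c by (auto intro: unit_with_parity_supported)
  have "(b \<star> c) \<star> (c' \<star> b') = b \<star> (c \<star> c') \<star> b'" by (simp only: conv_assoc)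
  then have 1: "(b \<star> c) \<star> (c' \<star> b') = delta \<one>" using sb b' c' by simp
  have "(c' \<star> b') \<star> (b \<star> c) = c' \<star> (b' \<star> b) \<star> c" by (simp only: conv_assoc)
  then have 2: "(c' \<star> b') \<star> (b \<star> c) = delta \<one>" using sb b' c' by simp
  define f where "f = a + e + scale 2 (a \<star> e)"
  have "b \<star> c = delta \<one> + scale 2 f"
    using a e by (simp add: f_def conv_add scale_add)
  moreover have "supported f" using a e by (simp add: f_def)
  moreover have "(\<Sum>y\<in>D. f y) = (\<Sum>y\<in>D. a y) + (\<Sum>y\<in>D. e y) + 2 * (\<Sum>y\<in>D. (a \<star> e) y)"
    by (simp add: f_def sum.distrib sum_distrib_left)
  then have "[(\<Sum>y\<in>D. f y) = m + k] (mod 2)"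
    using cong_add[OF a(3) e(3)] by (simp add: cong_def)
  ultimately show ?thesis unfolding unit_with_parity_def using 1 2 by blast
qed

lemma unit_with_parity_conj_by:
  assumes b: "unit_with_parity D m b" and g: "g \<in> carrier G" and D: "D \<subseteq> carrier G"
    "\<And>g y. g \<in> carrier G \<Longrightarrow> y \<in> D \<Longrightarrow> g \<otimes> y \<otimes> inv g \<in> D"
  shows "unit_with_parity D m (conj_by g b)"
proof -
  obtain b' a where b': "b \<star> b' = delta \<one>" "b' \<star> b = delta \<one>"
    and a: "supported a" "b = delta \<one> + scale 2 a" "[(\<Sum>y\<in>D. a y) = m] (mod 2)"
    using b unfolding unit_with_parity_def by blast
  have "conj_by g b \<star> conj_by g b' = delta \<one>" "conj_by g b' \<star> conj_by g b = delta \<one>"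
    using b' g by (simp_all flip: conj_by_conv)
  moreover have "conj_by g b = delta \<one> + scale 2 (conj_by g a)"
  proof -
    have "conj_by g b = conj_by g (delta \<one>) + scale 2 (conj_by g a)"
      unfolding a(2) by (simp add: conj_by_def conv_add)
    then show ?thesis using g by simp
  qed
  moreover have "[(\<Sum>y\<in>D. conj_by g a y) = m] (mod 2)"
  proof -
    have "(\<Sum>y\<in>D. conj_by g a y) = (\<Sum>y\<in>D. a y)" by (rule conj_by_sum[OF g D])
    then show ?thesis using a(3) by (simp only:)
  qed
  ultimately show ?thesis unfolding unit_with_parity_def by blast
qed

text \<open>The conjugates of \<open>b\<close> by the powers of \<open>z\<close> are supported on \<open>H\<close> and commute with \<open>H\<close>, hence with each
  other. So conjugation by \<open>z\<close>, which permutes them cyclically, fixes their product. The number of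
  factors is the group order, and as this is odd the parity is preserved.\<close>

lemma unit_climb:
  assumes b: "unit_with_parity D 1 b" and odd: "odd (order G)"
    and H: "subgroup H G" "\<And>y. y \<notin> H \<Longrightarrow> b y = 0" "\<And>h. h \<in> H \<Longrightarrow> delta h \<star> b = b \<star> delta h"
    and z: "z \<in> carrier G" "\<And>h. h \<in> H \<Longrightarrow> z \<otimes> h \<otimes> inv z \<in> H" "\<And>h. h \<in> H \<Longrightarrow> inv z \<otimes> h \<otimes> z \<in> H"
    and D: "D \<subseteq> carrier G" "\<And>g y. g \<in> carrier G \<Longrightarrow> y \<in> D \<Longrightarrow> g \<otimes> y \<otimes> inv g \<in> D"
  obtains u where "unit_with_parity D 1 u" "\<And>y. y \<notin> H \<Longrightarrow> u y = 0"
    "\<And>h. h \<in> H \<Longrightarrow> delta h \<star> u = u \<star> delta h" "delta z \<star> u = u \<star> delta z"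
proof -
  have Hc: "H \<subseteq> carrier G" using H(1) by (rule subgroup.subset)
  define c where "c k = conj_by (z [^] k) b" for k :: nat
  have c_Suc: "c (Suc k) = conj_by z (c k)" for k
    using z(1) by (simp only: c_def conj_by_conj_by nat_pow_closed nat_pow_Suc2)
  have sb: "supported b" using b by (rule unit_with_parity_supported)
  have c0: "c 0 = b" using sb by (simp add: c_def)
  have unit: "unit_with_parity D 1 (c k)" for k
    unfolding c_def using unit_with_parity_conj_by[OF b _ D] z(1) by simp
  have c_supp: "c k y = 0" if "y \<notin> H" for k y
    using that
  proof (induction k arbitrary: y)
    case (Suc k)
    show ?case
    proof (cases "y \<in> carrier G")
      case True
      have "inv z \<otimes> y \<otimes> z \<notin> H"
      proof
        assume "inv z \<otimes> y \<otimes> z \<in> H"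
        from z(2)[OF this] have "y \<in> H" using z(1) True by (simp add: m_assoc) (simp flip: m_assoc)
        then show False using Suc.prems by simp
      qed
      then show ?thesis using Suc.IH z(1) True by (simp add: c_Suc conj_by_apply)
    qed (use supported_conj_by[of z "c k"] in \<open>simp add: c_Suc supported_def del: supported_conj_by\<close>)
  qed (use H(2) c0 in simp)
  have c_comm: "delta h \<star> c k = c k \<star> delta h" if "h \<in> H" for h k
    using that
  proof (induction k arbitrary: h)
    case (Suc k)
    define h' where "h' = inv z \<otimes> h \<otimes> z"
    have h: "h \<in> carrier G" "h' \<in> H" "h' \<in> carrier G"
      using Suc.prems z(3)[OF Suc.prems] Hc by (auto simp: h'_def)
    have "conj_by z (delta h') = delta (z \<otimes> h' \<otimes> inv z)"
      using z(1) h by (simp add: conj_by_def delta_mult)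
    also have "z \<otimes> h' \<otimes> inv z = h"
      using z(1) h by (simp add: h'_def m_assoc) (simp flip: m_assoc)
    finally have dh: "conj_by z (delta h') = (delta h :: 'a \<Rightarrow> int)" .
    have "conj_by z (delta h' \<star> c k) = conj_by z (c k \<star> delta h')" using Suc.IH[OF h(2)] by simp
    then show ?case using z(1) by (simp add: conj_by_conv dh c_Suc)
  qed (use H(3) c0 in simp)
  have cc: "c i \<star> c j = c j \<star> c i" for i j
    by (rule supported_on_commute[OF c_supp Hc c_comm])
  define p where "p m = rec_nat (delta \<one>) (\<lambda>k f. f \<star> c k) m" for m
  have p0: "p 0 = delta \<one>" and pS: "p (Suc m) = p m \<star> c m" for m by (simp_all add: p_def)
  have p_unit: "unit_with_parity D (int m) (p m)" for m
  proof (induction m)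
    case (Suc m)
    then show ?case using unit_with_parity_conv[OF Suc unit[of m]] by (simp add: pS add.commute)
  qed (simp add: p0 unit_with_parity_one)
  have p_supp: "p m y = 0" if "y \<notin> H" for m y
    using that
  proof (induction m arbitrary: y)
    case 0
    then show ?case using subgroup.one_closed[OF H(1)] by (auto simp: p0 delta_def)
  next
    case (Suc m)
    show ?case
    proof (cases "y \<in> carrier G")
      case True
      have "p m t * c m (inv t \<otimes> y) = 0" if t: "t \<in> carrier G" for t
      proof (cases "t \<in> H")
        case tH: True
        have "inv t \<otimes> y \<notin> H"
        proof
          assume "inv t \<otimes> y \<in> H"
          from subgroup.m_closed[OF H(1) tH this] have "y \<in> H" using t True by (simp flip: m_assoc)
          then show False using Suc.prems by simp
        qed
        then show ?thesis by (simp add: c_supp)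
      qed (simp add: Suc.IH)
      then show ?thesis using True by (simp add: pS conv_apply)
    qed (simp add: pS conv_def)
  qed
  have p_comm: "delta h \<star> p m = p m \<star> delta h" if h: "h \<in> H" for h m
  proof (induction m)
    case 0
    have "h \<in> carrier G" using h Hc by blast
    then show ?case by (simp add: p0)
  next
    case (Suc m)
    have "delta h \<star> p (Suc m) = (delta h \<star> p m) \<star> c m" by (simp only: pS conv_assoc)
    also have "\<dots> = p m \<star> (delta h \<star> c m)" by (simp only: Suc conv_assoc)
    also have "\<dots> = p (Suc m) \<star> delta h" by (simp only: c_comm[OF h] pS conv_assoc)
    finally show ?case .
  qed
  \<comment> \<open>conjugating the product by \<open>z\<close> drops the factor \<open>c 0\<close> and appends \<open>c m\<close>\<close>
  have shift: "c 0 \<star> conj_by z (p m) = p (Suc m)" for m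
  proof (induction m)
    case 0
    then show ?case using z(1) sb by (simp add: p0 pS c0)
  next
    case (Suc m)
    have "c 0 \<star> conj_by z (p (Suc m)) = c 0 \<star> conj_by z (p m) \<star> c (Suc m)"
      using z(1) by (simp only: pS conj_by_conv c_Suc conv_assoc)
    then show ?case by (simp only: Suc pS)
  qed
  define n where "n = order G"
  have "c n = b" using z(1) sb by (simp add: c_def n_def pow_order_eq_1)
  then have "b \<star> conj_by z (p n) = p n \<star> b" using shift[of n] by (simp add: pS c0)
  also have "p n \<star> b = b \<star> p n"
    by (rule supported_on_commute[OF p_supp Hc H(3)])
  finally have eq: "b \<star> conj_by z (p n) = b \<star> p n" .
  obtain b' where b': "b' \<star> b = delta \<one>" using b unfolding unit_with_parity_def by blast
  have "b' \<star> b \<star> conj_by z (p n) = b' \<star> b \<star> p n" using eq by (simp only: conv_assoc)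
  then have "conj_by z (p n) = p n"
    using unit_with_parity_supported[OF p_unit] by (simp add: b')
  then have "delta z \<star> p n = p n \<star> delta z"
    using conj_by_eq_iff[OF z(1)] unit_with_parity_supported[OF p_unit] by blast
  moreover have "[int n = 1] (mod 2)"
    using odd by (simp add: n_def cong_def) presburger
  then have "unit_with_parity D 1 (p n)"
    using p_unit[of n] unfolding unit_with_parity_def by (blast intro: cong_trans)
  ultimately show thesis using that p_supp p_comm by blast
qed

text \<open>As long as \<open>H\<close> is a proper subgroup, there is an element of the upper central series outside \<open>H\<close>
  whose commutators all lie in \<open>H\<close>. It normalises \<open>H\<close>, so \<open>H\<close> can be enlarged by it.\<close>

lemma central_unit_exists:
  assumes reach: "upper_central G k = carrier G" and odd: "odd (order G)"
    and D: "D \<subseteq> carrier G" "\<And>g y. g \<in> carrier G \<Longrightarrow> y \<in> D \<Longrightarrow> g \<otimes> y \<otimes> inv g \<in> D"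
    and "unit_with_parity D 1 b" and "subgroup H G" "\<And>y. y \<notin> H \<Longrightarrow> b y = 0"
      "\<And>h. h \<in> H \<Longrightarrow> delta h \<star> b = b \<star> delta h"
  shows "\<exists>u. unit_with_parity D 1 u \<and> class_fun u"
  using assms(5-)
proof (induction "card (carrier G) - card H" arbitrary: H b rule: less_induct)
  case less
  note b = less.prems(1) and H = less.prems(2-4)
  have Hc: "H \<subseteq> carrier G" using H(1) by (rule subgroup.subset)
  show ?case
  proof (cases "H = carrier G")
    case True
    then have "class_fun b" using unit_with_parity_supported[OF b] H(3) by (intro class_funI) auto
    then show ?thesis using b by blast
  next
    case False
    define i where "i = (LEAST i. \<not> upper_central G i \<subseteq> H)"
    have "\<not> upper_central G k \<subseteq> H" using reach False Hc by auto
    then have i: "\<not> upper_central G i \<subseteq> H" unfolding i_def by (rule LeastI)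
    then have "i \<noteq> 0" using subgroup.one_closed[OF H(1)] by (cases i) auto
    then obtain j where j: "i = Suc j" by (cases i) auto
    have Zj: "upper_central G j \<subseteq> H" using not_less_Least[of j "\<lambda>i. \<not> upper_central G i \<subseteq> H"] j i_def by auto
    obtain z where z: "z \<in> upper_central G (Suc j)" "z \<notin> H" using i j by blast
    have zc: "z \<in> carrier G" using z(1) upper_central_subset by blast
    have norm: "t \<otimes> h \<otimes> inv t \<in> H" if t: "t \<in> upper_central G (Suc j)" and h: "h \<in> H" for t h
    proof -
      have th: "t \<in> carrier G" "h \<in> carrier G" using t h Hc upper_central_subset by auto
      have "t \<otimes> h \<otimes> inv t \<otimes> inv h \<in> H" using t th Zj unfolding upper_central_commutator by blast
      from subgroup.m_closed[OF H(1) this h] show ?thesis using th by (simp add: m_assoc)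
    qed
    have zi: "inv z \<in> upper_central G (Suc j)"
      using subgroup.m_inv_closed[OF normal_imp_subgroup[OF upper_central_normal] z(1)] .
    obtain u where u: "unit_with_parity D 1 u" "\<And>y. y \<notin> H \<Longrightarrow> u y = 0"
      "\<And>h. h \<in> H \<Longrightarrow> delta h \<star> u = u \<star> delta h" "delta z \<star> u = u \<star> delta z"
      using unit_climb[OF b odd H zc norm[OF z(1)] _ D] norm[OF zi] zc by auto
    define S where "S = {g \<in> carrier G. delta g \<star> u = u \<star> delta g}"
    have su: "supported u" using u(1) by (rule unit_with_parity_supported)
    have sS: "subgroup S G"
    proof (rule subgroupI)
      have "\<one> \<in> S" using su by (simp add: S_def)
      then show "S \<noteq> {}" by blast
      show "inv a \<in> S" if a: "a \<in> S" for a
      proof -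
        have ac: "a \<in> carrier G" "delta a \<star> u = u \<star> delta a" using a by (auto simp: S_def)
        then have "conj_by a u = u" using conj_by_eq_iff su by blast
        then have "conj_by (inv a) (conj_by a u) = conj_by (inv a) u" by simp
        then have "conj_by (inv a) u = u" using ac su by (simp add: conj_by_conj_by)
        then show ?thesis using conj_by_eq_iff[of "inv a" u] ac su by (simp add: S_def)
      qed
      show "a \<otimes> c \<in> S" if a: "a \<in> S" "c \<in> S" for a c
      proof -
        have ac: "a \<in> carrier G" "c \<in> carrier G" "delta a \<star> u = u \<star> delta a" "delta c \<star> u = u \<star> delta c"
          using a by (auto simp: S_def)
        then have "conj_by a (conj_by c u) = u" using conj_by_eq_iff su by metis
        then have "conj_by (a \<otimes> c) u = u" using ac by (simp add: conj_by_conj_by)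
        then show ?thesis using conj_by_eq_iff[of "a \<otimes> c" u] ac su by (simp add: S_def)
      qed
    qed (auto simp: S_def)
    define H' where "H' = generate G (insert z H)"
    have sub: "insert z H \<subseteq> carrier G" using zc Hc by auto
    have H': "subgroup H' G" unfolding H'_def by (rule generate_is_subgroup[OF sub])
    have HH': "insert z H \<subseteq> H'" unfolding H'_def by (auto intro: generate.incl)
    have "insert z H \<subseteq> S" using u(3,4) zc Hc by (auto simp: S_def)
    then have H'S: "H' \<subseteq> S" unfolding H'_def using sS by (rule generate_subgroup_incl)
    have fin: "finite H'" using subgroup.subset[OF H'] finite_carrier by (rule finite_subset)
    have "card H < card H'" using HH' z(2) fin by (intro psubset_card_mono) auto
    moreover have "card H' \<le> card (carrier G)"
      using subgroup.subset[OF H'] finite_carrier by (rule card_mono[rotated])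
    ultimately have "card (carrier G) - card H' < card (carrier G) - card H" by linarith
    then show ?thesis
      using less.hyps[of H' u] u(1) H' u(2) HH' H'S by (auto simp: S_def subset_iff)
  qed
qed

end

section \<open>A nontrivial central unit\<close>

context finite_group
begin

lemma cube_ne_one:
  assumes x: "x \<in> carrier G" and no: "\<not> conjugate G (x [^] (2::nat)) (inv x)"
  shows "x [^] (3::nat) \<noteq> \<one>"
proof
  assume "x [^] (3::nat) = \<one>"
  then have "x [^] (2::nat) \<otimes> x = \<one>" using x by (simp add: numeral_3_eq_3 numeral_2_eq_2)
  then have "inv x = x [^] (2::nat)" using x by (intro inv_equality) auto
  then have "conjugate G (x [^] (2::nat)) (inv x)"
    unfolding conjugate_def by (intro bexI[of _ \<one>]) (use x in simp_all)
  then show False using no by simp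
qed

lemma conj_pow:
  assumes h: "h \<in> carrier G" and z: "z \<in> carrier G"
  shows "(h \<otimes> z \<otimes> inv h) [^] (e::nat) = h \<otimes> z [^] e \<otimes> inv h"
proof (induction e)
  case (Suc e)
  have "(h \<otimes> z \<otimes> inv h) [^] Suc e = (h \<otimes> z [^] e \<otimes> inv h) \<otimes> (h \<otimes> z \<otimes> inv h)"
    by (simp only: nat_pow_Suc Suc)
  also have "\<dots> = h \<otimes> (z [^] e \<otimes> ((inv h \<otimes> h) \<otimes> z)) \<otimes> inv h"
    using h z by (simp only: m_assoc m_closed inv_closed nat_pow_closed)
  finally show ?case using h z by simp
qed (use h in simp)

text \<open>The exponents \<open>t\<close> for which \<open>x\<close> is conjugate to \<open>x ^ t\<close> are closed under powers. They are congruent to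
  \<open>1\<close> modulo \<open>3\<close>, since some power of the conjugating element with odd exponent is the identity. If
  one of them were not congruent to \<open>1\<close> modulo \<open>9\<close>, then its powers would reach \<open>-2\<close>.\<close>

lemma conjugate_power:
  assumes x: "x \<in> carrier G" and ord: "order G = 3 ^ n"
    and no: "\<not> conjugate G (x [^] (2::nat)) (inv x)"
    and t: "conjugate G x (x [^] (t::nat))"
  shows "t mod 9 = 1"
proof (rule ccontr)
  assume t9: "t mod 9 \<noteq> 1"
  obtain g where g: "g \<in> carrier G" "x [^] t = g \<otimes> x \<otimes> inv g"
    using t by (auto simp: conjugate_def)
  have pow: "g \<otimes> x [^] (i::nat) \<otimes> inv g = (x [^] t) [^] i" for i
    unfolding g(2) using conj_pow g x by simp
  have iter: "g [^] (k::nat) \<otimes> x \<otimes> inv (g [^] k) = x [^] (t ^ k)" for k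
  proof (induction k)
    case (Suc k)
    have "g [^] Suc k \<otimes> x \<otimes> inv (g [^] Suc k) = g \<otimes> (g [^] k \<otimes> x \<otimes> inv (g [^] k)) \<otimes> inv g"
      using g x by (simp only: nat_pow_Suc2[OF g(1)]) (simp add: inv_mult_group m_assoc)
    also have "\<dots> = (x [^] t) [^] (t ^ k)" unfolding Suc by (rule pow)
    finally show ?case using x by (simp add: nat_pow_pow)
  qed (use x in simp)
  have x3: "x [^] (3::nat) \<noteq> \<one>" using cube_ne_one[OF x no] .
  have n: "n \<noteq> 0"
  proof
    assume "n = 0"
    then have "x [^] (1::nat) = \<one>" using ord pow_order_eq_1[OF x] by simp
    then show False using x x3 by simp
  qed
  have "x = x [^] (t ^ order G)" using iter[of "order G"] g x by (simp add: pow_order_eq_1)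
  then have "[int (t ^ order G) = 1] (mod int (ord x))"
    using int_pow_eq[OF x, of "int 1" "int (t ^ order G)"] x
    by (simp only: cong_iff_dvd_diff int_pow_int) simp
  moreover have "3 dvd ord x"
  proof -
    have "normalization_semidom_class.prime (3::nat)" by simp
    then obtain m where m: "ord x = 3 ^ m"
      using ord_dvd_group_order[OF x] ord by (metis divides_primepow_nat)
    have "m \<noteq> 0" using m x x3 pow_ord_eq_1[OF x] by (metis nat_pow_eone nat_pow_one power_0)
    then show ?thesis by (simp add: m)
  qed
  then have "3 dvd int (ord x)" by (metis int_dvd_int_iff of_nat_numeral)
  ultimately have "[int (t ^ order G) = 1] (mod 3)" by (rule cong_dvd_modulus)
  then have "[t ^ order G = 1] (mod 3)" using cong_int_iff[of "t ^ order G" 1 3] by simp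
  have t3: "t mod 3 = 1"
  proof -
    have odd: "odd (order G)" by (simp add: ord)
    have "t mod 3 = 0 \<or> t mod 3 = 1 \<or> t mod 3 = 2" by presburger
    moreover have "t mod 3 \<noteq> 0"
    proof
      assume "t mod 3 = 0"
      then have "3 dvd t ^ order G" using order_pos by (simp add: dvd_power_le mod_eq_0_iff_dvd dvd_trans[OF _ dvd_power])
      then show False using \<open>[t ^ order G = 1] (mod 3)\<close> by (simp add: cong_def mod_eq_0_iff_dvd)
    qed
    moreover have "t mod 3 \<noteq> 2"
    proof
      assume "t mod 3 = 2"
      then have "[int t = -1] (mod 3)" by (simp add: cong_def) presburger
      then have "[int t ^ order G = (-1) ^ order G] (mod 3)" by (rule cong_pow)
      then have "[int t ^ order G = -1] (mod 3)" using odd by simp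
      moreover have "[int t ^ order G = 1] (mod 3)"
        using \<open>[int (t ^ order G) = 1] (mod 3)\<close> by simp
      ultimately show False by (simp add: cong_def)
    qed
    ultimately show ?thesis by blast
  qed
  have "(3 ^ n - 2) mod 3 = (1::nat)"
  proof -
    obtain m where m: "n = Suc m" using n by (cases n) auto
    obtain r where "(3::nat) ^ m = Suc r" by (metis not0_implies_Suc power_not_zero zero_neq_numeral)
    then have "(3::nat) ^ n - 2 = 3 * r + 1" by (simp add: m)
    then show ?thesis by simp
  qed
  \<comment> \<open>\<open>3 ^ n - 2\<close> is the natural number that stands for the exponent \<open>-2\<close>\<close>
  then obtain k where k: "[t ^ k = 3 ^ n - 2] (mod order G)"
    using one_mod_three_generator_nat[OF t3 t9, of "3 ^ n - 2" n] ord by auto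
  have "x [^] (3 ^ n - 2 :: nat) \<otimes> x [^] (2::nat) = x [^] order G"
  proof -
    have "(3::nat) ^ 1 \<le> 3 ^ n" using n by (intro power_increasing) auto
    then have "3 ^ n - 2 + 2 = (3::nat) ^ n" by simp
    then show ?thesis by (simp only: nat_pow_mult[OF x] ord)
  qed
  then have "inv (x [^] (2::nat)) = x [^] (3 ^ n - 2 :: nat)"
    using x by (intro inv_equality) (auto simp: pow_order_eq_1)
  then have "g [^] k \<otimes> x \<otimes> inv (g [^] k) = inv (x [^] (2::nat))"
    using iter[of k] pow_cong[OF x k] by simp
  then have "inv (g [^] k \<otimes> x \<otimes> inv (g [^] k)) = x [^] (2::nat)" using x by simp
  then have e: "g [^] k \<otimes> inv x \<otimes> inv (g [^] k) = x [^] (2::nat)"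
    using g x by (simp add: inv_mult_group m_assoc)
  have "inv x = inv (g [^] k) \<otimes> x [^] (2::nat) \<otimes> inv (inv (g [^] k))"
    unfolding e[symmetric] using g x by (simp add: m_assoc) (simp flip: m_assoc)
  then have "conjugate G (x [^] (2::nat)) (inv x)"
    unfolding conjugate_def by (rule bexI[of _ "inv (g [^] k)"]) (use g in simp)
  then show False using no by contradiction
qed

definition power_class :: "'a \<Rightarrow> nat \<Rightarrow> 'a set" where
  "power_class x s = {x [^] i | i :: nat. i mod 9 = s mod 9}"

lemma sum_power_class_shift:
  assumes x: "x \<in> carrier G" and nine: "9 dvd order G"
  shows "(\<Sum>y\<in>power_class x (s + k). (delta (x [^] k) \<star> f) y) = (\<Sum>y\<in>power_class x s. f y)"
proof (rule sum.reindex_bij_witness[of _ "\<lambda>y. x [^] k \<otimes> y" "\<lambda>y. inv (x [^] k) \<otimes> y"])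
  fix y assume "y \<in> power_class x (s + k)"
  then obtain i where i: "y = x [^] i" "i mod 9 = (s + k) mod 9" by (auto simp: power_class_def)
  have y: "y \<in> carrier G" using i x by simp
  show "x [^] k \<otimes> (inv (x [^] k) \<otimes> y) = y" using x y by (simp flip: m_assoc)
  have "inv (x [^] k) \<otimes> y = x [^] (k * (order G - 1) + i)"
    using x i by (simp add: inv_pow_eq nat_pow_mult)
  moreover have "(k * (order G - 1) + i) mod 9 = s mod 9"
  proof -
    have "[k * (order G - 1) + i = k * (order G - 1) + (s + k)] (mod 9)"
      using i by (intro cong_add) (auto simp: cong_def)
    also have "k * (order G - 1) + (s + k) = s + k * order G" using order_pos by (cases "order G") auto
    also have "[\<dots> = s + 0] (mod 9)" using nine by (intro cong_add) (auto simp: cong_0_iff)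
    finally show ?thesis by (simp add: cong_def)
  qed
  ultimately show "inv (x [^] k) \<otimes> y \<in> power_class x s" by (auto simp: power_class_def)
  show "f (inv (x [^] k) \<otimes> y) = (delta (x [^] k) \<star> f) y" using x y by (simp add: delta_conv)
next
  fix y assume "y \<in> power_class x s"
  then obtain i where i: "y = x [^] i" "i mod 9 = s mod 9" by (auto simp: power_class_def)
  show "inv (x [^] k) \<otimes> (x [^] k \<otimes> y) = y" using x i by (simp flip: m_assoc)
  have "x [^] k \<otimes> y = x [^] (k + i)" using x i by (simp add: nat_pow_mult)
  moreover have "(k + i) mod 9 = (s + k) mod 9"
    using i(2) by (metis mod_add_right_eq add.commute)
  ultimately show "x [^] k \<otimes> y \<in> power_class x (s + k)" unfolding power_class_def by blast
qed

lemma sum_power_class_delta: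
  assumes x: "x \<in> carrier G" and nine: "9 dvd ord x"
  shows "(\<Sum>y\<in>power_class x s. delta (x [^] i) y) = (if i mod 9 = s mod 9 then 1 else 0)"
proof -
  have fin: "finite (power_class x s)"
    by (rule finite_subset[OF _ finite_carrier]) (use x in \<open>auto simp: power_class_def\<close>)
  have "x [^] i \<in> power_class x s \<longleftrightarrow> i mod 9 = s mod 9"
  proof
    assume "x [^] i \<in> power_class x s"
    then obtain j where j: "x [^] i = x [^] j" "j mod 9 = s mod 9" by (auto simp: power_class_def)
    then have "int (ord x) dvd int j - int i"
      using int_pow_eq[OF x, of "int i" "int j"] by (simp add: int_pow_int)
    moreover have "9 dvd int (ord x)" using nine by (metis of_nat_dvd_iff of_nat_numeral)
    ultimately have "9 dvd int j - int i" by (rule dvd_trans[rotated])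
    then have "[int j = int i] (mod int 9)" by (simp add: cong_iff_dvd_diff)
    then have "[j = i] (mod 9)" unfolding cong_int_iff .
    then show "i mod 9 = s mod 9" using j(2) by (simp add: cong_def)
  qed (auto simp: power_class_def)
  then show ?thesis using fin by (simp add: delta_def)
qed

text \<open>Write \<open>T s\<close> for the sum of \<open>a\<close> over the powers of \<open>x\<close> with exponent congruent to \<open>s\<close> modulo \<open>9\<close>. The
  equation for \<open>a\<close> says that, modulo \<open>2\<close>, five consecutive \<open>T s\<close> add up to \<open>1\<close> if the last index is
  \<open>5\<close> or \<open>8\<close> and to \<open>0\<close> otherwise. If all \<open>T s\<close> with \<open>s\<close> prime to \<open>3\<close> were even, then the windows
  ending in \<open>2\<close>, \<open>4\<close> and \<open>5\<close> would reduce to \<open>T 0\<close> even, \<open>T 3 + T 0\<close> even and \<open>T 3\<close> odd.\<close>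

lemma odd_power_class_exists:
  fixes a r :: "'a \<Rightarrow> int"
  assumes x: "x \<in> carrier G" and nine: "9 dvd ord x" and y: "2 * K mod 9 = (1::nat)"
    and eq: "peval (delta x) (alternating [:0, 1:]) \<star> a
      = delta (x [^] K) + delta (x [^] (7 * K)) + scale 2 r"
    and sa: "supported a"
  shows "\<exists>s. \<not> 3 dvd s \<and> odd (\<Sum>y\<in>power_class x s. a y)"
proof (rule ccontr)
  assume no: "\<not> ?thesis"
  define T where "T s = (\<Sum>y\<in>power_class x s. a y)" for s
  have nineG: "9 dvd order G" using nine ord_dvd_group_order[OF x] by (rule dvd_trans)
  have per: "T (s + 9) = T s" for s by (simp add: T_def power_class_def)
  have ev: "even (T s)" if "\<not> 3 dvd s" for s using no that by (auto simp: T_def)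
  have alt: "peval (delta x) (alternating [:0, 1:]) = (delta \<one> - delta (x [^] (1::nat))
      + delta (x [^] (2::nat)) - delta (x [^] (3::nat)) + delta (x [^] (4::nat)) :: 'a \<Rightarrow> int)"
    unfolding alternating_def
    by (simp only: peval_add peval_diff peval_X_power[OF x] peval_one
      peval_X_power[OF x, of 1, simplified power_one_right])
  have shift: "(\<Sum>y\<in>power_class x (s + 4). (delta (x [^] k) \<star> a) y) = T (s + (4 - k))" if "k \<le> 4" for s k
    using sum_power_class_shift[OF x nineG, where s = "s + (4 - k)" and k = k and f = a] that by (simp add: T_def)
  have shift0: "(\<Sum>y\<in>power_class x (s + 4). a y) = T (s + 4)" for s by (simp add: T_def)
  have lhs: "(\<Sum>y\<in>power_class x (s + 4). (peval (delta x) (alternating [:0, 1:]) \<star> a) y)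
      = T (s + 4) - T (s + 3) + T (s + 2) - T (s + 1) + T s" for s
    unfolding alt conv_add conv_diff conv_one_left[OF sa]
    using shift[of 1 s] shift[of 2 s] shift[of 3 s] shift[of 4 s]
    by (simp add: sum.distrib sum_subtractf shift0)
  have "K mod 9 = (K + 9 * K) mod 9" by (simp only: mod_mult_self2)
  also have "K + 9 * K = 5 * (2 * K)" by simp
  also have "5 * (2 * K) mod 9 = 5 * (2 * K mod 9) mod 9" by (simp only: mod_mult_right_eq)
  finally have K5: "K mod 9 = 5" by (simp add: y)
  have "7 * K mod 9 = 7 * (K mod 9) mod 9" by (simp only: mod_mult_right_eq)
  then have K: "K mod 9 = 5" "7 * K mod 9 = 8" by (simp_all add: K5)
  have rhs: "even ((\<Sum>y\<in>power_class x s. (delta (x [^] K) + delta (x [^] (7 * K)) + scale 2 r) y)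
      - (if s mod 9 = 5 \<or> s mod 9 = 8 then 1 else 0))" for s
    using K by (simp add: sum.distrib sum_power_class_delta[OF x nine] flip: sum_distrib_left)
  have main: "even (T (s + 4) - T (s + 3) + T (s + 2) - T (s + 1) + T s
      - (if (s + 4) mod 9 = 5 \<or> (s + 4) mod 9 = 8 then 1 else 0))" for s
    using lhs[of s] rhs[of "s + 4"] unfolding eq by metis
  \<comment> \<open>the shifts are separate variables so that they can be given as numerals\<close>
  have main': "even (T s4 - T s3 + T s2 - T s1 + T s - (if s4 mod 9 = 5 \<or> s4 mod 9 = 8 then 1 else 0))"
    if "s1 = s + 1" "s2 = s + 2" "s3 = s + 3" "s4 = s + 4" for s s1 s2 s3 s4
    using main[of s] by (simp only: that)
  have evs: "even (T 1)" "even (T 2)" "even (T 4)" "even (T 5)"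
    "even (T 7)" "even (T 8)" "even (T 10)" "even (T 11)"
    by (rule ev, simp)+
  \<comment> \<open>the index \<open>11\<close> stands for \<open>2\<close>, so that the window starts at a natural number\<close>
  have "even (T 9)" using main'[of 8 7 9 10 11] evs by simp
  then have "even (T 0)" using per[of 0] by simp
  moreover have "even (T 3 + T 0)" using main'[of 1 0 2 3 4] evs by simp
  moreover have "odd (T 3)" using main'[of 2 1 3 4 5] evs by simp
  ultimately show False by simp
qed

lemma class_fun_inverse:
  assumes u: "class_fun u" and v: "supported v" "u \<star> v = delta \<one>" "v \<star> u = delta \<one>"
  shows "class_fun v"
proof (rule class_funI)
  fix g assume g: "g \<in> carrier G"
  have "delta g \<star> v = (v \<star> u) \<star> delta g \<star> v" using g v by simp
  also have "\<dots> = v \<star> (u \<star> delta g) \<star> v" by (simp only: conv_assoc)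
  also have "\<dots> = v \<star> delta g \<star> (u \<star> v)" by (simp only: class_fun_commute[OF u] conv_assoc)
  also have "\<dots> = v \<star> delta g" by (simp only: v conv_one_right supported_intros)
  finally show "delta g \<star> v = v \<star> delta g" .
qed (rule v)

text \<open>The class of elements conjugate to a power of \<open>x\<close> with exponent in a suitable residue class modulo
  \<open>9\<close> detects, at every stage of the passage from \<open>cyclic_unit\<close> to a central unit, that the unit
  has a coefficient congruent to \<open>2\<close> modulo \<open>4\<close> away from the identity.
  The exponent \<open>k\<close> is such that \<open>2 ^ Suc k = 4 ^ (3 ^ n)\<close> is \<open>1\<close> modulo the group order.\<close>

theorem nontrivial_central_unit:
  assumes ord: "order G = 3 ^ n" and x: "x \<in> carrier G"
    and no: "\<not> conjugate G (x [^] (2::nat)) (inv x)"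
  shows "\<exists>u v :: 'a \<Rightarrow> int. class_fun u \<and> class_fun v \<and> u \<star> v = delta \<one> \<and>
    (\<forall>z. u \<noteq> delta z \<and> u \<noteq> - delta z)"
proof -
  have three: "normalization_semidom_class.prime (3::nat)" by simp
  have odd: "odd (order G)" by (simp add: ord)
  have "coprime (5::nat) 3" by (rule primes_coprime) simp_all
  then have co: "coprime 5 (order G)" by (simp add: ord)
  obtain m where m: "ord x = 3 ^ m"
    using ord_dvd_group_order[OF x] ord by (metis divides_primepow_nat three)
  have nine: "9 dvd ord x"
  proof (rule ccontr)
    assume "\<not> 9 dvd ord x"
    then have "\<not> 3 ^ 2 dvd (3::nat) ^ m" by (simp add: m)
    then have "m < 2" using le_imp_power_dvd[of 2 m "3::nat"] by linarith
    then have "ord x dvd 3" unfolding m by (cases m) auto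
    then have "x [^] (3::nat) = \<one>" using pow_eq_id[OF x] by blast
    then show False using cube_ne_one[OF x no] by simp
  qed
  have nineG: "9 dvd order G" using nine ord_dvd_group_order[OF x] by (rule dvd_trans)
  define k :: nat where "k = 2 * 3 ^ n - 1"
  have "Suc k = 2 * 3 ^ n" by (simp add: k_def)
  then have pk: "(2::nat) ^ Suc k = 4 ^ 3 ^ n" by (simp only: power_mult) simp
  have k: "[2 ^ Suc k = 1] (mod order G)"
  proof -
    obtain c where "(4::int) ^ 3 ^ n = 1 + 3 ^ Suc n * c" using power_three_pow[of 4 n] by auto
    then have "[(4::int) ^ 3 ^ n = 1] (mod 3 ^ n)" by (simp add: cong_iff_dvd_diff)
    then have "[int (4 ^ 3 ^ n) = int 1] (mod int (3 ^ n))" by simp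
    then show ?thesis unfolding pk ord cong_int_iff .
  qed
  have K: "2 * 2 ^ k mod 9 = (1::nat)"
    using cong_dvd_modulus_nat[OF k nineG] by (simp add: cong_def)
  obtain p p' a r :: "int poly"
    where pp: "peval (delta x) p \<star> peval (delta x) p' = delta \<one>"
    and pa: "peval (delta x) p = delta \<one> + scale 2 (peval (delta x) a)"
    and eq: "peval (delta x) (alternating [:0, 1:]) \<star> peval (delta x) a
      = delta (x [^] (2 ^ k :: nat)) + delta (x [^] (7 * 2 ^ k :: nat)) + scale 2 (peval (delta x) r)"
    using cyclic_unit[OF x odd co k] .
  define b where "b = peval (delta x) p"
  obtain s where s: "\<not> 3 dvd s" "odd (\<Sum>y\<in>power_class x s. peval (delta x) a y)"
    using odd_power_class_exists[OF x nine K eq] by auto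
  define D where "D = {h \<otimes> y \<otimes> inv h | h y. h \<in> carrier G \<and> y \<in> power_class x s}"
  have pc: "power_class x s \<subseteq> carrier G" using x by (auto simp: power_class_def)
  have Dc: "D \<subseteq> carrier G" using pc by (auto simp: D_def)
  have Dinv: "g \<otimes> y \<otimes> inv g \<in> D" if g: "g \<in> carrier G" and y: "y \<in> D" for g y
  proof -
    obtain h t where ht: "y = h \<otimes> t \<otimes> inv h" "h \<in> carrier G" "t \<in> power_class x s"
      using y by (auto simp: D_def)
    then have "g \<otimes> y \<otimes> inv g = (g \<otimes> h) \<otimes> t \<otimes> inv (g \<otimes> h)"
      using g pc by (auto simp: inv_mult_group m_assoc)
    then show ?thesis unfolding D_def using ht g m_closed by blast
  qed
  \<comment> \<open>conjugation does not mix the residues modulo \<open>9\<close>, so passing from \<open>\<langle>x\<rangle>\<close> to \<open>D\<close> loses nothing\<close>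
  have DP: "D \<inter> powers x = power_class x s"
  proof
    show "power_class x s \<subseteq> D \<inter> powers x"
    proof
      fix y assume y: "y \<in> power_class x s"
      then have "y = \<one> \<otimes> y \<otimes> inv \<one>" using pc by auto
      then have "y \<in> D" unfolding D_def using y by blast
      moreover have "y \<in> powers x" using y by (auto simp: power_class_def powers_def)
      ultimately show "y \<in> D \<inter> powers x" by blast
    qed
    show "D \<inter> powers x \<subseteq> power_class x s"
    proof
      fix y assume "y \<in> D \<inter> powers x"
      then obtain h i j where y: "y = x [^] (i::nat)" "x [^] i = h \<otimes> x [^] (j::nat) \<otimes> inv h"
        "h \<in> carrier G" "j mod 9 = s mod 9"
        by (auto simp: D_def powers_def power_class_def)
      have "\<not> 3 dvd j" using y(4) s(1) dvd_mod_iff[of 3 9 j] dvd_mod_iff[of 3 9 s] by simp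
      then have "coprime j (order G)"
        using ord three by (metis coprime_commute coprime_power_left_iff prime_imp_coprime)
      then obtain j' where j': "[j * j' = 1] (mod order G)" using cong_solve_coprime_nat by auto
      have "x [^] (i * j') = h \<otimes> x [^] (j * j') \<otimes> inv h"
        using arg_cong[OF y(2), of "\<lambda>g. g [^] j'"] x y(3) by (simp only: conj_pow nat_pow_closed nat_pow_pow)
      also have "x [^] (j * j') = x" using pow_cong[OF x j'] x by simp
      finally have "conjugate G x (x [^] (i * j'))" using y(3) by (auto simp: conjugate_def)
      from conjugate_power[OF x ord no this] have "(i * j') mod 9 = 1" .
      moreover have "(j * j') mod 9 = 1" using cong_dvd_modulus_nat[OF j' nineG] by (simp add: cong_def)
      ultimately have "[i * j' * j = j] (mod 9)" "[i * (j * j') = i] (mod 9)"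
        using cong_scalar_right[of "i * j'" 1 9 j] cong_scalar_left[of "j * j'" 1 9 i] by (auto simp: cong_def)
      then have "[i = j] (mod 9)" by (metis cong_sym cong_trans mult.assoc mult.commute)
      then have "i mod 9 = s mod 9" using y(4) by (simp add: cong_def)
      then show "y \<in> power_class x s" unfolding power_class_def using y(1) by blast
    qed
  qed
  have finD: "finite D" using Dc finite_carrier by (rule finite_subset)
  have "(\<Sum>y\<in>D. peval (delta x) a y) = (\<Sum>y\<in>D \<inter> powers x. peval (delta x) a y)"
    using finD peval_powers[OF x] by (intro sum.mono_neutral_right) auto
  then have "odd (\<Sum>y\<in>D. peval (delta x) a y)" using s(2) by (simp add: DP)
  then have "[(\<Sum>y\<in>D. peval (delta x) a y) = 1] (mod 2)" by (simp add: cong_def odd_iff_mod_2_eq_one)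
  moreover have "peval (delta x) p' \<star> b = delta \<one>" using pp by (simp add: b_def peval_commute)
  ultimately have b: "unit_with_parity D 1 b"
    unfolding unit_with_parity_def using pp pa by (auto simp: b_def)
  obtain c where c: "upper_central G c = carrier G" using upper_central_reaches[OF three ord] .
  have "delta h \<star> b = b \<star> delta h" if h: "h \<in> powers x" for h
  proof -
    obtain i where "h = x [^] (i::nat)" using h by (auto simp: powers_def)
    then have "(delta h :: 'a \<Rightarrow> int) = peval (delta x) ([:0, 1:] ^ i)"
      using peval_X_power[OF x] by metis
    then show ?thesis unfolding b_def by (simp only: peval_commute[of _ "[:0, 1:] ^ i"])
  qed
  then obtain u where u: "unit_with_parity D 1 u" "class_fun u"
    using central_unit_exists[OF c odd Dc Dinv b subgroup_powers[OF x]] peval_powers[OF x] b_def by metis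
  obtain v where v: "supported v" "u \<star> v = delta \<one>" "v \<star> u = delta \<one>"
    using u(1) unfolding unit_with_parity_def by blast
  have "class_fun v" using class_fun_inverse[OF u(2) v] .
  obtain e where e: "u = delta \<one> + scale 2 e" "[(\<Sum>y\<in>D. e y) = 1] (mod 2)"
    using u(1) unfolding unit_with_parity_def by blast
  have oneD: "\<one> \<notin> D"
  proof
    assume "\<one> \<in> D"
    moreover have "\<one> \<in> powers x" using subgroup.one_closed[OF subgroup_powers[OF x]] .
    ultimately have "\<one> \<in> power_class x s" using DP by blast
    then obtain i where i: "x [^] (i::nat) = \<one>" "i mod 9 = s mod 9" by (auto simp: power_class_def)
    then have "9 dvd i" using nine pow_eq_id[OF x] by (metis dvd_trans)
    then have "9 dvd s" using i(2) by (simp add: mod_eq_0_iff_dvd)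
    then show False using s(1) dvd_trans[of 3 9 s] by simp
  qed
  have triv: "u \<noteq> scale d (delta z)" if d: "d = 1 \<or> d = -1" for d :: int and z
  proof
    assume uz: "u = scale d (delta z)"
    have "1 + 2 * e \<one> = d * delta z \<one>" using fun_cong[OF uz, of \<one>] by (simp add: e(1) delta_def)
    have "delta z \<one> \<noteq> (0 :: int)"
    proof
      assume "delta z \<one> = (0 :: int)"
      then have "1 + 2 * e \<one> = 0" using \<open>1 + 2 * e \<one> = d * delta z \<one>\<close> by simp
      then show False by presburger
    qed
    then have "z = \<one>" by (auto simp: delta_def split: if_splits)
    then have "e y = 0" if "y \<noteq> \<one>" for y
      using fun_cong[OF uz, of y] that by (simp add: e(1) delta_def)
    then have "(\<Sum>y\<in>D. e y) = 0" using oneD by (intro sum.neutral) metis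
    then show False using e(2) by (simp add: cong_def)
  qed
  have "u \<noteq> delta z \<and> u \<noteq> - delta z" for z
    using triv[of 1 z] triv[of "-1" z] by (auto simp: fun_eq_iff)
  then show ?thesis using u(2) \<open>class_fun v\<close> v(2) by blast
qed

end

section \<open>The cut property\<close>

context finite_group
begin

lemma carrier_group_ring: "carrier (group_ring G) = {f. supported f}"
proof -
  have "{x. f x \<noteq> 0} \<subseteq> carrier G \<longleftrightarrow> supported f" for f :: "'a \<Rightarrow> int"
    by (auto simp: supported_def)
  then show ?thesis
    using finite_subset[OF _ finite_carrier] by (auto simp: group_ring_def)
qed

lemma mult_group_ring:
  assumes "supported f"
  shows "f \<otimes>\<^bsub>group_ring G\<^esub> h = f \<star> h"
proof
  fix x
  have "(\<Sum>y | f y \<noteq> 0. f y * h (inv y \<otimes> x)) = (\<Sum>y\<in>carrier G. f y * h (inv y \<otimes> x))"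
    by (rule sum.mono_neutral_left) (use assms finite_carrier in \<open>auto simp: supported_def\<close>)
  then show "(f \<otimes>\<^bsub>group_ring G\<^esub> h) x = (f \<star> h) x" by (simp add: group_ring_def conv_def)
qed

lemma one_group_ring: "\<one>\<^bsub>group_ring G\<^esub> = delta \<one>"
  by (simp add: group_ring_def delta_def)

lemma Units_group_ring:
  "Units (group_ring G) = {u. supported u \<and> (\<exists>v. supported v \<and> u \<star> v = delta \<one> \<and> v \<star> u = delta \<one>)}"
  by (auto simp: Units_def carrier_group_ring mult_group_ring one_group_ring)

lemma mem_center_units_group_ring:
  "u \<in> center (units_of (group_ring G)) \<longleftrightarrow> u \<in> Units (group_ring G) \<and>
     (\<forall>w\<in>Units (group_ring G). u \<star> w = w \<star> u)"
proof -
  have "supported w" if "w \<in> Units (group_ring G)" for w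
    using that by (simp add: Units_group_ring)
  then show ?thesis
    by (simp add: center_def units_of_def mult_group_ring cong: conj_cong)
qed

text \<open>A central unit commutes in particular with the group elements, which are units, and is
  therefore constant on conjugacy classes.\<close>

lemma center_units_group_ring:
  "u \<in> center (units_of (group_ring G)) \<longleftrightarrow>
     class_fun u \<and> (\<exists>v. class_fun v \<and> u \<star> v = delta \<one>)"
proof
  assume "u \<in> center (units_of (group_ring G))"
  then have uU: "u \<in> Units (group_ring G)"
    and comm: "\<And>w. w \<in> Units (group_ring G) \<Longrightarrow> u \<star> w = w \<star> u"
    unfolding mem_center_units_group_ring by blast+
  obtain v where su: "supported u" and v: "supported v" "u \<star> v = delta \<one>" "v \<star> u = delta \<one>"
    using uU unfolding Units_group_ring by blast
  have "class_fun u"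
  proof (rule class_funI[OF su])
    fix g assume "g \<in> carrier G"
    then have "delta g \<star> delta (inv g) = (delta \<one> :: 'a \<Rightarrow> int)"
      "delta (inv g) \<star> delta g = (delta \<one> :: 'a \<Rightarrow> int)"
      "supported (delta g :: 'a \<Rightarrow> int)" "supported (delta (inv g) :: 'a \<Rightarrow> int)"
      by (simp_all add: delta_mult)
    then have "delta g \<in> Units (group_ring G)" unfolding Units_group_ring by blast
    then show "delta g \<star> u = u \<star> delta g" using comm by simp
  qed
  then show "class_fun u \<and> (\<exists>v. class_fun v \<and> u \<star> v = delta \<one>)"
    using class_fun_inverse v by blast
next
  assume "class_fun u \<and> (\<exists>v. class_fun v \<and> u \<star> v = delta \<one>)"
  then obtain v where u: "class_fun u" and v: "class_fun v" "u \<star> v = delta \<one>" by blast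
  have "v \<star> u = delta \<one>" using v class_fun_commute[OF u] by simp
  then have "u \<in> Units (group_ring G)"
    using u v class_fun_supported unfolding Units_group_ring by blast
  then show "u \<in> center (units_of (group_ring G))"
    unfolding mem_center_units_group_ring using class_fun_commute[OF u] by blast
qed

lemma a_inv_group_ring:
  assumes "supported f" shows "\<ominus>\<^bsub>group_ring G\<^esub> f = - f"
proof -
  have "\<ominus>\<^bsub>group_ring G\<^esub> f = (THE y. y \<in> carrier (group_ring G) \<and>
      (\<lambda>x. f x + y x) = (\<lambda>_. 0) \<and> (\<lambda>x. y x + f x) = (\<lambda>_. 0))"
    by (simp add: a_inv_def m_inv_def group_ring_def)
  also have "\<dots> = - f"
    using assms
    by (intro the_equality) (auto simp: carrier_group_ring supported_def fun_eq_iff eq_neg_iff_add_eq_0 add.commute)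
  finally show ?thesis .
qed

lemma cut_property_iff:
  "cut_property G \<longleftrightarrow> {u. class_fun u \<and> (\<exists>v. class_fun v \<and> u \<star> v = delta \<one>)}
     = {u. \<exists>z\<in>center G. u = delta z \<or> u = - (delta z :: 'a \<Rightarrow> int)}"
proof -
  have "group_ring_of = (delta :: 'a \<Rightarrow> 'a \<Rightarrow> int)" by (simp add: fun_eq_iff group_ring_of_def delta_def)
  moreover have "\<ominus>\<^bsub>group_ring G\<^esub> delta g = - (delta g :: 'a \<Rightarrow> int)" if "g \<in> center G" for g
    using that by (intro a_inv_group_ring) (auto simp: center_def)
  ultimately have "(\<Union>g\<in>center G. {group_ring_of g, \<ominus>\<^bsub>group_ring G\<^esub> group_ring_of g})
      = {u. \<exists>z\<in>center G. u = delta z \<or> u = - (delta z :: 'a \<Rightarrow> int)}"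
    by auto
  moreover have "center (units_of (group_ring G)) = {u. class_fun u \<and> (\<exists>v. class_fun v \<and> u \<star> v = delta \<one>)}"
    by (intro Set.set_eqI) (simp only: center_units_group_ring mem_Collect_eq)
  ultimately show ?thesis unfolding cut_property_def by (simp only:)
qed

lemma class_fun_delta:
  assumes "z \<in> center G" shows "class_fun (delta z)"
  using assms by (intro class_funI) (auto simp: center_def delta_mult)

lemma cut_property_iff_conjugate:
  assumes ord: "order G = 3 ^ n"
  shows "cut_property G \<longleftrightarrow> (\<forall>x\<in>carrier G. conjugate G (x [^] (2::nat)) (inv x))"
proof
  assume cut: "cut_property G"
  show "\<forall>x\<in>carrier G. conjugate G (x [^] (2::nat)) (inv x)"
  proof (rule ccontr)
    assume "\<not> ?thesis"
    then obtain x where "x \<in> carrier G" "\<not> conjugate G (x [^] (2::nat)) (inv x)" by blast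
    from nontrivial_central_unit[OF ord this]
    show False using cut unfolding cut_property_iff set_eq_iff by blast
  qed
next
  assume cond: "\<forall>x\<in>carrier G. conjugate G (x [^] (2::nat)) (inv x)"
  show "cut_property G"
    unfolding cut_property_iff
  proof (intro equalityI subsetI)
    fix u :: "'a \<Rightarrow> int"
    assume "u \<in> {u. class_fun u \<and> (\<exists>v. class_fun v \<and> u \<star> v = delta \<one>)}"
    then show "u \<in> {u. \<exists>z\<in>center G. u = delta z \<or> u = - delta z}"
      using central_unit_trivial[OF ord cond] by blast
  next
    fix u :: "'a \<Rightarrow> int"
    assume "u \<in> {u. \<exists>z\<in>center G. u = delta z \<or> u = - delta z}"
    then obtain z where z: "z \<in> center G" and "u = delta z \<or> u = - delta z" by blast
    then obtain c :: int where c: "u = scale c (delta z)" "c * c = 1"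
    proof -
      assume *: "\<And>c. u = scale c (delta z) \<Longrightarrow> c * c = 1 \<Longrightarrow> thesis"
      show thesis using \<open>u = delta z \<or> u = - delta z\<close> *[of 1] *[of "-1"] by (auto simp: fun_eq_iff)
    qed
    have zc: "z \<in> carrier G" using z by (simp add: center_def)
    have zi: "inv z \<in> center G"
      using z by (auto simp: center_def) (metis inv_closed inv_inv inv_mult_group)
    have "u \<star> scale c (delta (inv z)) = delta \<one>" using c zc by (simp add: delta_mult)
    then show "u \<in> {u. class_fun u \<and> (\<exists>v. class_fun v \<and> u \<star> v = delta \<one>)}"
      using class_fun_delta[OF z] class_fun_delta[OF zi] c by blast
  qed
qed

end

theorem theorem2:
  fixes G :: "('a, 'b) monoid_scheme"
  assumes "group G" and "finite (carrier G)" and "\<exists>n. order G = 3 ^ n"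
  shows "(cut_property G \<longleftrightarrow>
            (\<forall>x \<in> carrier G. conjugate G (x [^]\<^bsub>G\<^esub> (2::nat)) (inv\<^bsub>G\<^esub> x)))
       \<and> (cut_property G \<longrightarrow>
            (\<forall>i\<ge>1. lower_central G i \<noteq> {\<one>\<^bsub>G\<^esub>} \<longrightarrow>
               group_exponent (G\<lparr>carrier := lower_central G i\<rparr> Mod lower_central G (i + 1)) = 3)
          \<and> (\<forall>i. upper_central G i \<noteq> carrier G \<longrightarrow>
               group_exponent (G\<lparr>carrier := upper_central G (i + 1)\<rparr> Mod upper_central G i) = 3))"
proof -
  interpret finite_group G
    using assms(1,2) by (simp add: finite_group_def finite_group_axioms_def)
  obtain n where ord: "order G = 3 ^ n" using assms(3) by blast
  show ?thesis
    unfolding cut_property_iff_conjugate[OF ord]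
    using lower_central_quotient_exponent[OF ord] upper_central_quotient_exponent[OF ord] by blast
qed

end
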